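(* Let $\beta>0$, let $\mu$ be the Marchenko-Pastur law with parameter $\beta$, and let $\nu$ be any compactly supported probability measure on $\mathbb{R}$. Then for all real $z<z^*_{\mu\boxplus\nu}$, $$U_{\mu\boxplus\nu}(z)=\inf_{g\in(0,g^*_{\mu\boxplus\nu}):\ z-\operatorname{supp}_-\nu<\frac{\beta}{1+g}}\left\{\beta\log(1+g)-\frac{\beta g}{1+g}+\int\log\left(\lambda-z+\frac{\beta}{1+g}\right)\nu(d\lambda)\right\}.$$
   Context: The Marchenko-Pastur law with parameter $\beta>0$ is the probability measure $\max(1-\beta,0)\,\delta_0+\frac{\sqrt{(\lambda_+-\lambda)(\lambda-\lambda_-)}}{2\pi\lambda}1_{[\lambda_-,\lambda_+]}(\lambda)\,d\lambda$ with $\lambda_\pm=(1\pm\sqrt\beta)^2$. $\mu\boxplus\nu$ denotes the free additive convolution of the compactly supported probability measures $\mu,\nu$ on $\mathbb{R}$. For a compactly supported probability measure $\rho$ on $\mathbb{R}$, $\operatorname{supp}_-\rho$ is the infimum of its support, $U_\rho(z)=\int\log|z-\lambda|\,\rho(d\lambda)$ is its logarithmic potential, and $G_\rho(z)=\int\frac{\rho(d\lambda)}{\lambda-z}$ is its Stieltjes transform (note the sign). $z^*_{\mu\boxplus\nu}=\operatorname{supp}_-(\mu\boxplus\nu)$ and $g^*_{\mu\boxplus\nu}=\lim_{z\uparrow z^*_{\mu\boxplus\nu}}G_{\mu\boxplus\nu}(z)\in(0,\infty]$. *)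

theory Defs
  imports "HOL-Probability.Probability" "HOL-Library.Poly_Mapping"
begin

section \<open>Compactly supported probability measures on the real line\<close>

definition supp :: "real measure \<Rightarrow> real set" where
  "supp \<rho> = {x. \<forall>U. open U \<and> x \<in> U \<longrightarrow> emeasure \<rho> U > 0}"

definition cs_prob :: "real measure \<Rightarrow> bool" where
  "cs_prob \<rho> \<longleftrightarrow> prob_space \<rho> \<and> sets \<rho> = sets borel \<and> compact (supp \<rho>)"

definition supp_minus :: "real measure \<Rightarrow> real" where
  "supp_minus \<rho> = Inf (supp \<rho>)"

text \<open>As \<open>ln 0 = 0\<close>, and as the integral of a non-integrable function is \<open>0\<close>, the next two
  definitions have the intended meaning only off the support; they are used below it.\<close>

definition log_potential :: "real measure \<Rightarrow> real \<Rightarrow> real" where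
  "log_potential \<rho> z = (\<integral>x. ln \<bar>z - x\<bar> \<partial>\<rho>)"

definition stieltjes :: "real measure \<Rightarrow> real \<Rightarrow> real" where
  "stieltjes \<rho> z = (\<integral>x. 1 / (x - z) \<partial>\<rho>)"

definition g_star :: "real measure \<Rightarrow> ereal" where
  "g_star \<rho> = Lim (at_left (supp_minus \<rho>)) (\<lambda>z. ereal (stieltjes \<rho> z))"


section \<open>The Marchenko--Pastur law\<close>

definition mp_minus :: "real \<Rightarrow> real" where "mp_minus \<beta> = (1 - sqrt \<beta>)\<^sup>2"
definition mp_plus :: "real \<Rightarrow> real" where "mp_plus \<beta> = (1 + sqrt \<beta>)\<^sup>2"

definition mp_density :: "real \<Rightarrow> real \<Rightarrow> real" where
  "mp_density \<beta> x =
     sqrt ((mp_plus \<beta> - x) * (x - mp_minus \<beta>)) / (2 * pi * x) * indicator {mp_minus \<beta>..mp_plus \<beta>} x"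

definition marchenko_pastur :: "real \<Rightarrow> real measure" where
  "marchenko_pastur \<beta> = measure_of UNIV (sets borel)
     (\<lambda>A. ennreal (max (1 - \<beta>) 0) * emeasure (return borel 0) A
          + emeasure (density lborel (\<lambda>x. ennreal (mp_density \<beta> x))) A)"

lemma sets_marchenko_pastur [simp]: "sets (marchenko_pastur \<beta>) = sets borel"
  unfolding marchenko_pastur_def
  using sets.sigma_sets_eq[of "borel :: real measure"] by (simp add: sets_measure_of)

lemma emeasure_marchenko_pastur:
  assumes "A \<in> sets borel"
  shows "emeasure (marchenko_pastur \<beta>) A =
    ennreal (max (1 - \<beta>) 0) * indicator A 0 + (\<integral>\<^sup>+x\<in>A. ennreal (mp_density \<beta> x) \<partial>lborel)"
proof -
  let ?f = "\<lambda>x. ennreal (mp_density \<beta> x)"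
  let ?m = "\<lambda>A. ennreal (max (1 - \<beta>) 0) * emeasure (return borel (0::real)) A
          + emeasure (density lborel ?f) A"
  have ca: "countably_additive (sets borel) ?m"
  proof (rule countably_additiveI)
    fix F :: "nat \<Rightarrow> real set"
    assume F: "range F \<subseteq> sets borel" "disjoint_family F" "(\<Union>i. F i) \<in> sets borel"
    have "suminf (\<lambda>i. ?m (F i)) = ennreal (max (1 - \<beta>) 0) * suminf (\<lambda>i. emeasure (return borel 0) (F i))
        + suminf (\<lambda>i. emeasure (density lborel ?f) (F i))"
      by (simp add: suminf_add[symmetric] ennreal_suminf_cmult)
    also have "\<dots> = ?m (\<Union>i. F i)"
      using F suminf_emeasure[of F "return borel 0"] suminf_emeasure[of F "density lborel ?f"]
      by simp
    finally show "suminf (\<lambda>i. ?m (F i)) = ?m (\<Union>i. F i)" .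
  qed
  have "emeasure (marchenko_pastur \<beta>) A = ?m A"
    by (rule emeasure_measure_of[OF marchenko_pastur_def])
       (use assms ca in \<open>auto simp: positive_def\<close>)
  moreover have "?f \<in> borel_measurable borel"
    unfolding mp_density_def by measurable
  ultimately show ?thesis
    using assms by (simp add: emeasure_density)
qed


section \<open>Free additive convolution\<close>

text \<open>Words in the letters \<open>False\<close>, \<open>True\<close> form the free monoid on two generators. Finitely
  supported functions on it, with convolution as product, form the algebra
  \<open>\<complex>\<langle>X, Y\<rangle>\<close> of noncommutative polynomials.\<close>

datatype nc_word = NC_Word "bool list"

instantiation nc_word :: monoid_add
begin

definition zero_nc_word :: nc_word where "0 = NC_Word []"

fun plus_nc_word :: "nc_word \<Rightarrow> nc_word \<Rightarrow> nc_word" where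
  "NC_Word u + NC_Word v = NC_Word (u @ v)"

instance
proof
  fix a b c :: nc_word
  show "a + b + c = a + (b + c)" by (cases a; cases b; cases c) simp
  show "0 + a = a" "a + 0 = a" by (cases a; simp add: zero_nc_word_def)+
qed

end

type_synonym nc_poly = "nc_word \<Rightarrow>\<^sub>0 complex"

definition nc_var :: "bool \<Rightarrow> nc_poly" where
  "nc_var i = Poly_Mapping.single (NC_Word [i]) 1"

definition nc_const :: "complex \<Rightarrow> nc_poly" where
  "nc_const c = Poly_Mapping.single 0 c"

definition nc_eval :: "complex poly \<Rightarrow> nc_poly \<Rightarrow> nc_poly" where
  "nc_eval p a = (\<Sum>k\<le>degree p. nc_const (coeff p k) * a ^ k)"

text \<open>A unital linear functional on \<open>\<complex>\<langle>X, Y\<rangle>\<close> is the joint distribution of a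
  pair \<open>(a, b)\<close> of noncommutative random variables: its value at \<open>P\<close> is the
  expectation of \<open>P(a, b)\<close>.\<close>

definition joint_distribution :: "(nc_poly \<Rightarrow> complex) \<Rightarrow> bool" where
  "joint_distribution \<phi> \<longleftrightarrow>
     (\<forall>p q. \<phi> (p + q) = \<phi> p + \<phi> q) \<and> (\<forall>c p. \<phi> (nc_const c * p) = c * \<phi> p) \<and> \<phi> 1 = 1"

text \<open>Freeness of \<open>a\<close> and \<open>b\<close>: alternating products of centred elements
  of the algebras generated by \<open>a\<close> and by \<open>b\<close> are centred.\<close>

definition free_pair :: "(nc_poly \<Rightarrow> complex) \<Rightarrow> bool" where
  "free_pair \<phi> \<longleftrightarrow>
     (\<forall>ps :: (bool \<times> complex poly) list.
        ps \<noteq> [] \<and> distinct_adj (map fst ps) \<and> (\<forall>(i, p) \<in> set ps. \<phi> (nc_eval p (nc_var i)) = 0)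
        \<longrightarrow> \<phi> (prod_list (map (\<lambda>(i, p). nc_eval p (nc_var i)) ps)) = 0)"

definition has_law :: "(nc_poly \<Rightarrow> complex) \<Rightarrow> nc_poly \<Rightarrow> real measure \<Rightarrow> bool" where
  "has_law \<phi> a \<mu> \<longleftrightarrow> (\<forall>n. \<phi> (a ^ n) = complex_of_real (\<integral>x. x ^ n \<partial>\<mu>))"

text \<open>\<open>\<rho>\<close> is the law of \<open>a + b\<close>, for free \<open>a\<close>, \<open>b\<close> with laws
  \<open>\<mu>\<close>, \<open>\<nu>\<close>. Freeness and the marginals determine \<open>\<phi>\<close>, so it need not be
  required to be positive, and a compactly supported law is determined by its moments; hence for
  compactly supported \<open>\<mu>\<close>, \<open>\<nu>\<close> there is exactly one such \<open>\<rho>\<close>, by the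
  existence of free products of \<open>C\<^sup>*\<close>-probability spaces.\<close>

definition is_free_convolution :: "real measure \<Rightarrow> real measure \<Rightarrow> real measure \<Rightarrow> bool" where
  "is_free_convolution \<mu> \<nu> \<rho> \<longleftrightarrow> cs_prob \<rho> \<and>
     (\<exists>\<phi>. joint_distribution \<phi> \<and> free_pair \<phi> \<and>
        has_law \<phi> (nc_var False) \<mu> \<and> has_law \<phi> (nc_var True) \<nu> \<and>
        has_law \<phi> (nc_var False + nc_var True) \<rho>)"

end

(* Haagerup's argument for the R-transform: if A = 1 + x and B = 1 + y are the resolvents of the free
   variables a and b, normalized so that x and y are centred, then 1/A + 1/B - 1 = 1/A (1 - x y) 1/B,
   and the expectation of its inverse B (1 - x y)^{-1} A is 1 by freeness. For a Marchenko-Pastur a,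
   whose R-transform is rational, this yields the subordination equation G_rho(z) = G_nu(omega(z)),
   omega(z) = z - beta/(1 + G_rho(z)), near infinity. It extends to all z < supp_- rho, because omega
   cannot reach supp_- nu: the inverse of omega would continue G_nu analytically past the end of the
   support. Then for fixed z the g-derivative of the objective is a positive multiple of
   g - G_nu(z - beta/(1 + g)), whose only sign change is at g = G_rho(z), and the value there has the
   same z-derivative and the same behaviour at -infinity as U_rho. *)

theory Submission
  imports Defs "HOL-Complex_Analysis.Complex_Analysis" "HOL-Real_Asymp.Real_Asymp"
begin

text \<open>The free convolution is given through a mere linear functional on noncommutative
  polynomials: there is no norm and no positivity, so resolvents of the variables exist only as
  formal power series. The series parameter t is the common value of - G for the two variables and
  for their sum, each taken at its own argument z; its coefficients are noncommutative polynomials,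
  and scalar series are central. Analysis starts only once a relation between scalar series is left,
  and with the sign convention for G the series t M(t) of the moments is - G(1/t). The
  Marchenko-Pastur law enters through a quadratic equation for its transform on z < 0, obtained from
  an explicit antiderivative. The formal relation knows only a neighbourhood of infinity. It
  continues over a half-plane because \<Omega> moves nonreal points to nonreal points, which leaves
  the real axis as the only place where continuation can fail.\<close>

unbundle fps_syntax
unbundle no vec_syntax

section \<open>Additivity of the R-transform for formal power series\<close>

subsection \<open>Geometric series over a noncommutative ring\<close>

text \<open>The geometric series of \<open>F\<close>, meant for \<open>F $ 0 = 0\<close>: then
  \<open>F ^ n\<close> starts in degree n, so the powers with n \<le> k determine coefficient k. The
  coefficients need not commute, so both one-sided inverse laws have to be checked.\<close>

definition fps_geo :: "'a::ring_1 fps \<Rightarrow> 'a fps" where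
  "fps_geo F = Abs_fps (\<lambda>k. (\<Sum>n\<le>k. F ^ n) $ k)"

lemma fps_power_nth_below:
  fixes F :: "'a::ring_1 fps"
  assumes "F $ 0 = 0" "j < n"
  shows "(F ^ n) $ j = 0"
  using assms(2)
proof (induction n arbitrary: j)
  case (Suc n)
  have "F $ i * (F ^ n) $ (j - i) = 0" if "i \<le> j" for i
    using that Suc by (cases "i = 0") (auto simp: assms(1))
  then show ?case
    by (simp add: fps_mult_nth)
qed simp

lemma fps_geo_nth:
  assumes "F $ 0 = 0" "j \<le> N"
  shows "fps_geo F $ j = (\<Sum>n\<le>N. F ^ n) $ j"
proof -
  have "(\<Sum>n\<le>j. (F ^ n) $ j) = (\<Sum>n\<le>N. (F ^ n) $ j)"
    by (rule sum.mono_neutral_left) (use assms in \<open>auto simp: fps_power_nth_below\<close>)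
  then show ?thesis
    by (simp add: fps_geo_def fps_sum_nth)
qed

lemma fps_mult_nth_cong:
  fixes F G H :: "'a::ring_1 fps"
  assumes "\<And>j. j \<le> k \<Longrightarrow> G $ j = H $ j"
  shows "(F * G) $ k = (F * H) $ k" "(G * F) $ k = (H * F) $ k"
  by (auto simp: fps_mult_nth assms intro!: sum.cong)

lemma fps_geo_inverse:
  assumes "F $ 0 = 0"
  shows "(1 - F) * fps_geo F = 1" "fps_geo F * (1 - F) = 1"
proof -
  have tele: "(1 - F) * (\<Sum>n\<le>k. F ^ n) = 1 - F ^ Suc k" "(\<Sum>n\<le>k. F ^ n) * (1 - F) = 1 - F ^ Suc k" for k
  proof (induction k)
    case (Suc k)
    { case 1 then show ?case
        by (simp only: sum.atMost_Suc distrib_left Suc(1)) (simp add: left_diff_distrib)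
    next
      case 2 then show ?case
        by (simp only: sum.atMost_Suc distrib_right Suc(2)) (simp add: right_diff_distrib power_commutes mult.assoc) }
  qed simp_all
  have "((1 - F) * fps_geo F) $ k = 1 $ k" for k
  proof -
    have "((1 - F) * fps_geo F) $ k = ((1 - F) * (\<Sum>n\<le>k. F ^ n)) $ k"
      by (rule fps_mult_nth_cong) (rule fps_geo_nth[OF assms])
    then show ?thesis
      using fps_power_nth_below[OF assms, of k "Suc k"] by (simp add: tele del: power_Suc)
  qed
  then show "(1 - F) * fps_geo F = 1" by (simp add: fps_eq_iff)
  have "(fps_geo F * (1 - F)) $ k = 1 $ k" for k
  proof -
    have "(fps_geo F * (1 - F)) $ k = ((\<Sum>n\<le>k. F ^ n) * (1 - F)) $ k"
      by (rule fps_mult_nth_cong) (rule fps_geo_nth[OF assms])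
    then show ?thesis
      using fps_power_nth_below[OF assms, of k "Suc k"] by (simp add: tele del: power_Suc)
  qed
  then show "fps_geo F * (1 - F) = 1" by (simp add: fps_eq_iff)
qed

subsection \<open>Scalar power series and functionals\<close>

lemma nc_const_add: "nc_const (c + d) = nc_const c + nc_const d"
  by (simp add: nc_const_def single_add)

lemma nc_const_mult: "nc_const (c * d) = nc_const c * nc_const d"
  by (simp add: nc_const_def mult_single)

lemma nc_const_0 [simp]: "nc_const 0 = 0"
  by (simp add: nc_const_def)

lemma nc_const_1 [simp]: "nc_const 1 = 1"
  by (simp add: nc_const_def)

lemma nc_const_sum: "nc_const (sum f A) = (\<Sum>x\<in>A. nc_const (f x))"
  by (induction A rule: infinite_finite_induct) (auto simp: nc_const_add)

lemma nc_const_commute: "nc_const c * p = p * nc_const c"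
proof -
  have "Poly_Mapping.single 0 c * p = p * Poly_Mapping.single 0 c"
  proof (induction p rule: update_induct)
    case (update f k v)
    have "Poly_Mapping.update k v f = f + Poly_Mapping.single k v"
      using update(1) by (intro poly_mapping_eqI) (auto simp: lookup_update lookup_add lookup_single not_in_keys_iff_lookup_eq_zero)
    then show ?case
      using update by (simp add: distrib_left distrib_right mult_single mult.commute)
  qed simp
  then show ?thesis by (simp add: nc_const_def)
qed

text \<open>Scalar series are central among the series over noncommutative polynomials, so they can
  be moved past the variables.\<close>

definition scal :: "complex fps \<Rightarrow> nc_poly fps" where
  "scal f = Abs_fps (\<lambda>n. nc_const (f $ n))"

lemma scal_nth [simp]: "scal f $ n = nc_const (f $ n)"
  by (simp add: scal_def)

lemma scal_add: "scal (f + g) = scal f + scal g"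
  by (simp add: fps_eq_iff nc_const_add)

lemma scal_mult: "scal (f * g) = scal f * scal g"
  by (simp add: fps_eq_iff fps_mult_nth nc_const_sum nc_const_mult)

lemma scal_0 [simp]: "scal 0 = 0"
  by (simp add: fps_eq_iff)

lemma scal_1 [simp]: "scal 1 = 1"
  by (simp add: fps_eq_iff)

lemma scal_uminus: "scal (- f) = - scal f"
  using scal_add[of f "- f"] by (simp add: eq_neg_iff_add_eq_0 add.commute)

lemma scal_diff: "scal (f - g) = scal f - scal g"
  using scal_add[of f "- g"] by (simp add: scal_uminus)

lemma scal_commute: "scal f * F = F * scal f"
proof -
  have "(\<Sum>i=0..n. nc_const (f $ i) * F $ (n - i)) = (\<Sum>i=0..n. F $ i * nc_const (f $ (n - i)))" for n
    by (subst sum.atLeastAtMost_rev) (auto intro!: sum.cong simp: nc_const_commute)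
  then show ?thesis
    by (simp add: fps_eq_iff fps_mult_nth)
qed

lemma scal_const_power: "(scal X * fps_const a) ^ n = scal (X ^ n) * fps_const (a ^ n)"
proof (induction n)
  case (Suc n)
  have "(scal X * fps_const a) ^ Suc n = scal X * (fps_const a * scal (X ^ n)) * fps_const (a ^ n)"
    by (simp only: power_Suc Suc mult.assoc)
  also have "fps_const a * scal (X ^ n) = scal (X ^ n) * fps_const a"
    by (rule scal_commute[symmetric])
  also have "scal X * (scal (X ^ n) * fps_const a) * fps_const (a ^ n)
      = scal (X ^ Suc n) * (fps_const a * fps_const (a ^ n))"
    by (simp only: power_Suc scal_mult mult.assoc)
  finally show ?case by simp
qed simp

definition fps_functional :: "(nc_poly \<Rightarrow> complex) \<Rightarrow> nc_poly fps \<Rightarrow> complex fps" where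
  "fps_functional \<phi> F = Abs_fps (\<lambda>n. \<phi> (F $ n))"

lemma fps_functional_nth [simp]: "fps_functional \<phi> F $ n = \<phi> (F $ n)"
  by (simp add: fps_functional_def)

context
  fixes \<phi> :: "nc_poly \<Rightarrow> complex"
  assumes jd: "joint_distribution \<phi>"
begin

lemma functional_add: "\<phi> (p + q) = \<phi> p + \<phi> q"
  using jd by (simp add: joint_distribution_def)

lemma functional_scale: "\<phi> (nc_const c * p) = c * \<phi> p"
  using jd by (simp add: joint_distribution_def)

lemma functional_1: "\<phi> 1 = 1"
  using jd by (simp add: joint_distribution_def)

lemma functional_0: "\<phi> 0 = 0"
  using functional_add[of 0 0] by simp

lemma functional_sum: "\<phi> (sum f A) = (\<Sum>x\<in>A. \<phi> (f x))"
  by (induction A rule: infinite_finite_induct) (auto simp: functional_0 functional_add)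

lemma functional_diff: "\<phi> (p - q) = \<phi> p - \<phi> q"
  using functional_add[of "p - q" q] by simp

lemma fps_functional_scal: "fps_functional \<phi> (scal f * F) = f * fps_functional \<phi> F"
  by (simp add: fps_eq_iff fps_mult_nth functional_sum functional_scale)

text \<open>As \<open>X\<close> is central, the n-th power splits into \<open>X ^ n\<close> and
  \<open>a ^ n\<close>, and linearity turns the expectation of the resolvent into the moment series
  of \<open>a\<close> at \<open>X\<close>.\<close>

lemma fps_functional_geo:
  assumes "X $ 0 = 0"
  shows "fps_functional \<phi> (fps_geo (scal X * fps_const a)) = Abs_fps (\<lambda>n. \<phi> (a ^ n)) oo X"
proof -
  have "\<phi> ((\<Sum>n\<le>k. (scal X * fps_const a) ^ n) $ k) = (\<Sum>n\<le>k. \<phi> (a ^ n) * (X ^ n) $ k)" for k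
    by (simp add: scal_const_power fps_sum_nth functional_sum functional_scale mult.commute)
  then show ?thesis
    by (simp add: fps_eq_iff fps_geo_def fps_compose_nth atMost_atLeast0)
qed

end

section \<open>Freeness for power series with centred coefficients\<close>

definition centred :: "(nc_poly \<Rightarrow> complex) \<Rightarrow> bool \<Rightarrow> nc_poly set" where
  "centred \<phi> i = {p. \<phi> p = 0 \<and> (\<exists>q. p = nc_eval q (nc_var i))}"

lemma sum_powers_is_nc_eval:
  "\<exists>p. (\<Sum>n\<le>k. nc_const (c n) * a ^ n) = nc_eval p a"
proof -
  define p where "p = (\<Sum>n\<le>k. monom (c n) n)"
  have coeff: "coeff p n = (if n \<le> k then c n else 0)" for n
    by (simp add: p_def coeff_sum sum.delta if_distrib[of coeff] )
  have "degree p \<le> k"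
    by (rule degree_le) (simp add: coeff)
  then have "nc_eval p a = (\<Sum>n\<le>k. nc_const (coeff p n) * a ^ n)"
    unfolding nc_eval_def by (intro sum.mono_neutral_left) (auto simp: coeff_eq_0)
  also have "\<dots> = (\<Sum>n\<le>k. nc_const (c n) * a ^ n)"
    by (simp add: coeff)
  finally show ?thesis by metis
qed

text \<open>A coefficient of the product is a finite sum of products of coefficients, one from each
  factor, and each of these is an alternating word of centred polynomials.\<close>

lemma free_pair_alternating_fps:
  assumes jd: "joint_distribution \<phi>" and "free_pair \<phi>"
    and "distinct_adj (map fst L)" "L \<noteq> []"
    and L: "\<And>i F k. (i, F) \<in> set L \<Longrightarrow> F $ k \<in> centred \<phi> i"
  shows "\<phi> (prod_list (map snd L) $ k) = 0"
proof -
  \<comment> \<open>The induction expands one series at a time: \<open>ps\<close> holds the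
    polynomials already chosen as coefficients, \<open>L\<close> the series still to be
    expanded.\<close>
  have gen: "\<phi> (prod_list (map (\<lambda>(i, p). nc_eval p (nc_var i)) ps) * (prod_list (map snd L) $ k)) = 0"
    if "distinct_adj (map fst ps @ map fst L)" "ps @ map (\<lambda>(i, F). (i, 0)) L \<noteq> []"
      "\<forall>(i, p) \<in> set ps. \<phi> (nc_eval p (nc_var i)) = 0"
      "\<And>i F k. (i, F) \<in> set L \<Longrightarrow> F $ k \<in> centred \<phi> i"
    for ps :: "(bool \<times> complex poly) list" and L :: "(bool \<times> nc_poly fps) list" and k
    using that
  proof (induction L arbitrary: ps k)
    case Nil
    then have "\<phi> (prod_list (map (\<lambda>(i, p). nc_eval p (nc_var i)) ps)) = 0"
      using assms(2) by (auto simp: free_pair_def)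
    then show ?case
      by (simp add: functional_0[OF jd])
  next
    case (Cons iF L)
    obtain i F where iF: "iF = (i, F)" by (cases iF)
    let ?P = "prod_list (map (\<lambda>(i, p). nc_eval p (nc_var i)) ps)"
    have *: "\<phi> (?P * (F $ j * prod_list (map snd L) $ (k - j))) = 0" for j
    proof -
      have "F $ j \<in> centred \<phi> i"
        using Cons.prems(4)[of i F j] iF by simp
      then obtain q where q: "F $ j = nc_eval q (nc_var i)" "\<phi> (F $ j) = 0"
        by (auto simp: centred_def)
      have "\<phi> (prod_list (map (\<lambda>(i, p). nc_eval p (nc_var i)) (ps @ [(i, q)])) * prod_list (map snd L) $ (k - j)) = 0"
        by (rule Cons.IH) (use Cons.prems iF q in auto)
      then show ?thesis
        by (simp add: q mult.assoc)
    qed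
    have "?P * (prod_list (map snd (iF # L)) $ k) = (\<Sum>j=0..k. ?P * (F $ j * prod_list (map snd L) $ (k - j)))"
      by (simp add: iF fps_mult_nth sum_distrib_left)
    then show ?case
      by (simp add: functional_sum[OF jd] *)
  qed
  show ?thesis
    using gen[of "[]" L k] assms by auto
qed

text \<open>Here \<open>u = X / t\<close> for the compositional inverse \<open>X\<close> of
  \<open>t M(t)\<close>, with \<open>M\<close> the moment series of \<open>a\<close>; so \<open>1 / u = 1 + t R(t)\<close>
  for the R-transform \<open>R\<close>.\<close>

definition inverts_moments :: "(nat \<Rightarrow> complex) \<Rightarrow> complex fps \<Rightarrow> bool" where
  "inverts_moments m u \<longleftrightarrow> u $ 0 = 1 \<and> u * (Abs_fps m oo (fps_X * u)) = 1"

text \<open>This is (1/u - t a)^(-1) = (t (z - a))^(-1) with 1/z = t u, a rescaled resolvent of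
  \<open>a\<close>; when \<open>u\<close> inverts the moments, its expectation is 1.\<close>

definition resolv :: "complex fps \<Rightarrow> nc_poly \<Rightarrow> nc_poly fps" where
  "resolv u a = scal u * fps_geo (scal (fps_X * u) * fps_const a)"

definition inv_resolv :: "complex fps \<Rightarrow> nc_poly \<Rightarrow> nc_poly fps" where
  "inv_resolv u a = scal (inverse u) - scal fps_X * fps_const a"

lemma resolv_inverse:
  assumes "u $ 0 = 1"
  shows "inv_resolv u a * resolv u a = 1" "resolv u a * inv_resolv u a = 1"
proof -
  let ?F = "scal (fps_X * u) * fps_const a"
  have F0: "?F $ 0 = 0" by simp
  have uu: "scal u * scal (inverse u) = 1" "scal (inverse u) * scal u = 1"
    using assms by (simp_all flip: scal_mult add: inverse_mult_eq_1 inverse_mult_eq_1')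
  have "scal (inverse u) * ?F = scal (inverse u * u) * (scal fps_X * fps_const a)"
    by (simp only: mult.assoc[symmetric] scal_mult[symmetric]) (simp add: mult_ac)
  then have eq: "inv_resolv u a = scal (inverse u) * (1 - ?F)"
    using assms by (simp add: inv_resolv_def right_diff_distrib inverse_mult_eq_1)
  show "inv_resolv u a * resolv u a = 1"
  proof -
    have "inv_resolv u a * resolv u a = scal u * (scal (inverse u) * ((1 - ?F) * fps_geo ?F))"
      by (simp only: eq resolv_def mult.assoc scal_commute[of u])
    then show ?thesis by (simp add: fps_geo_inverse[OF F0] uu)
  qed
  show "resolv u a * inv_resolv u a = 1"
  proof -
    have "resolv u a * inv_resolv u a = scal u * (fps_geo ?F * (1 - ?F) * scal (inverse u))"
      by (simp only: eq resolv_def mult.assoc scal_commute[of "inverse u"])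
    then show ?thesis by (simp add: fps_geo_inverse[OF F0] uu)
  qed
qed

text \<open>The expectation of the resolvent is u M(t u) = 1 by the choice of \<open>u\<close>. In
  degree k only powers of the variable up to k occur, so the coefficient is a polynomial in
  it.\<close>

lemma resolv_minus_1_centred:
  assumes jd: "joint_distribution \<phi>" and u: "inverts_moments (\<lambda>n. \<phi> (nc_var i ^ n)) u"
  shows "(resolv u (nc_var i) - 1) $ k \<in> centred \<phi> i"
proof -
  let ?a = "nc_var i"
  let ?F = "scal (fps_X * u) * fps_const ?a"
  have F0: "?F $ 0 = 0" by simp
  have "fps_functional \<phi> (resolv u ?a) = 1"
    using u unfolding resolv_def
    by (simp add: fps_functional_scal[OF jd] fps_functional_geo[OF jd] inverts_moments_def)
  then have "\<phi> (resolv u ?a $ k) = 1 $ k"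
    by (metis fps_functional_nth)
  then have "\<phi> ((resolv u ?a - 1) $ k) = 0"
    by (simp add: functional_diff[OF jd] functional_1[OF jd] functional_0[OF jd])
  moreover have "(resolv u ?a - 1) $ k
      = (\<Sum>n\<le>k. nc_const ((u * (fps_X * u) ^ n) $ k - (if n = 0 then 1 $ k else 0)) * ?a ^ n)"
  proof -
    have "resolv u ?a $ k = (scal u * (\<Sum>n\<le>k. ?F ^ n)) $ k"
      unfolding resolv_def by (rule fps_mult_nth_cong) (rule fps_geo_nth[OF F0])
    also have "\<dots> = (\<Sum>n\<le>k. nc_const ((u * (fps_X * u) ^ n) $ k) * ?a ^ n)"
      by (simp add: scal_const_power sum_distrib_left fps_sum_nth flip: mult.assoc scal_mult)
    finally have r: "resolv u ?a $ k = (\<Sum>n\<le>k. nc_const ((u * (fps_X * u) ^ n) $ k) * ?a ^ n)" .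
    have "(\<Sum>n\<le>k. nc_const (if n = 0 then 1 $ k else 0) * ?a ^ n) = (\<Sum>n\<in>{0}. nc_const (1 $ k) * ?a ^ n)"
      by (rule sum.mono_neutral_cong_right) auto
    then have one: "(\<Sum>n\<le>k. nc_const (if n = 0 then 1 $ k else 0) * ?a ^ n) = 1 $ k"
      by simp
    have cd: "nc_const (c - d) = nc_const c - nc_const d" for c d
      by (metis nc_const_add add_diff_cancel diff_add_cancel)
    show ?thesis
      unfolding fps_sub_nth r cd left_diff_distrib sum_subtractf one ..
  qed
  ultimately show ?thesis
    using sum_powers_is_nc_eval[of "\<lambda>n. (u * (fps_X * u) ^ n) $ k - (if n = 0 then 1 $ k else 0)" ?a k]
    unfolding centred_def by auto
qed

theorem free_sum_inverts_moments:
  assumes jd: "joint_distribution \<phi>" and free: "free_pair \<phi>"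
    and u: "inverts_moments (\<lambda>n. \<phi> (nc_var False ^ n)) u"
    and v: "inverts_moments (\<lambda>n. \<phi> (nc_var True ^ n)) v"
  shows "inverts_moments (\<lambda>n. \<phi> ((nc_var False + nc_var True) ^ n)) (inverse (inverse u + inverse v - 1))"
proof -
  define a where "a = nc_var False"
  define b where "b = nc_var True"
  define w where "w = inverse (inverse u + inverse v - 1)"
  have u0: "u $ 0 = 1" and v0: "v $ 0 = 1" and w0: "w $ 0 = 1"
    using u v by (simp_all add: inverts_moments_def w_def)
  have winv: "inverse w = inverse u + inverse v - 1"
    unfolding w_def by (rule fps_inverse_idempotent) (simp add: u0 v0)
  define A where "A = resolv u a"
  define B where "B = resolv v b"
  define A' where "A' = inv_resolv u a"
  define B' where "B' = inv_resolv v b"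
  have AA: "A' * A = 1" "A * A' = 1" and BB: "B' * B = 1" "B * B' = 1"
    unfolding A_def B_def A'_def B'_def by (simp_all add: resolv_inverse u0 v0)
  have alpha: "(A - 1) $ k \<in> centred \<phi> False" for k
    unfolding A_def a_def by (rule resolv_minus_1_centred[OF jd u])
  have beta: "(B - 1) $ k \<in> centred \<phi> True" for k
    unfolding B_def b_def by (rule resolv_minus_1_centred[OF jd v])
  define T where "T = (A - 1) * (B - 1)"
  have T0: "T $ 0 = 0"
    by (simp add: T_def A_def B_def resolv_def u0 v0 fps_geo_def)
  define E where "E = B * fps_geo T * A"

  have P: "inv_resolv w (a + b) = A' * (1 - T) * B'"
  proof -
    have "A' * (1 - T) * B' = A' * (A + B - A * B) * B'"
      by (simp add: T_def algebra_simps)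
    also have "\<dots> = (A' * A) * B' + A' * (B * B') - (A' * A) * (B * B')"
      by (simp add: algebra_simps)
    also have "\<dots> = A' + B' - 1"
      by (simp add: AA BB)
    also have "\<dots> = inv_resolv w (a + b)"
      by (simp add: A'_def B'_def inv_resolv_def winv scal_add scal_diff algebra_simps flip: fps_const_add)
    finally show ?thesis ..
  qed
  have "inv_resolv w (a + b) * E = A' * (1 - T) * (B' * B) * fps_geo T * A"
    by (simp add: P E_def mult.assoc)
  also have "\<dots> = A' * ((1 - T) * fps_geo T) * A"
    by (simp add: BB mult.assoc)
  also have "\<dots> = 1"
    by (simp add: AA fps_geo_inverse[OF T0])
  finally have "inv_resolv w (a + b) * E = 1" .
  \<comment> \<open>\<open>E\<close> is a right inverse and \<open>resolv w (a + b)\<close> a left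
    inverse of the same element, hence they are equal.\<close>
  then have "resolv w (a + b) * (inv_resolv w (a + b) * E) = resolv w (a + b)"
    by simp
  then have E: "E = resolv w (a + b)"
    by (simp add: resolv_inverse[OF w0] flip: mult.assoc)

  \<comment> \<open>With x = A - 1 and y = B - 1, B (x y)^n A splits into y (x y)^n x, y (x y)^n, (x
    y)^n x and (x y)^n. All are alternating words of centred factors, so only the empty word, the
    last summand at n = 0, contributes.\<close>
  have pow: "\<phi> ((B * T ^ n * A) $ k) = (if n = 0 then 1 $ k else 0)" for n k
  proof -
    define L :: "(bool \<times> nc_poly fps) list"
      where "L = concat (replicate n [(False, A - 1), (True, B - 1)])"
    have L_prod: "prod_list (map snd L) = T ^ n"
      unfolding L_def T_def by (induction n) (auto simp: mult.assoc)
    have L_fst: "map fst L = concat (replicate n [False, True])"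
      unfolding L_def by (induction n) auto
    have dist: "distinct_adj (True # concat (replicate n [False, True]) @ [False])" for n
      by (induction n) auto
    have L_set: "F $ k \<in> centred \<phi> i" if "(i, F) \<in> set L" for i F k
      using that alpha beta unfolding L_def by (auto split: if_splits)
    have zero: "\<phi> (prod_list (map snd L') $ k) = 0"
      if "distinct_adj (map fst L')" "L' \<noteq> []" "set L' \<subseteq> set L \<union> {(False, A - 1), (True, B - 1)}" for L'
      by (rule free_pair_alternating_fps[OF jd free that(1,2)]) (use that alpha beta L_set in auto)
    \<comment> \<open>The longest of the four words; the others are contiguous parts of it and
      inherit the alternation.\<close>
    have d1: "distinct_adj (map fst ((True, B - 1) # L @ [(False, A - 1)]))"
      using dist[of n] by (simp add: L_fst)
    have d2: "distinct_adj (map fst ((True, B - 1) # L))" and d3: "distinct_adj (map fst (L @ [(False, A - 1)]))"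
      and d4: "distinct_adj (map fst L)"
      using d1 by (auto simp: distinct_adj_append_iff distinct_adj_Cons split: list.splits)
    have z1: "\<phi> (((B - 1) * T ^ n * (A - 1)) $ k) = 0"
      using zero[OF d1] by (simp add: L_prod mult.assoc subset_insertI2)
    have z2: "\<phi> (((B - 1) * T ^ n) $ k) = 0"
      using zero[OF d2] by (simp add: L_prod subset_insertI2)
    have z3: "\<phi> ((T ^ n * (A - 1)) $ k) = 0"
      using zero[OF d3] by (simp add: L_prod subset_insertI2)
    have z4: "\<phi> ((T ^ n) $ k) = (if n = 0 then 1 $ k else 0)"
    proof (cases "n = 0")
      case False
      then have "L \<noteq> []" by (cases n) (auto simp: L_def)
      then show ?thesis using zero[OF d4] False by (simp add: L_prod subset_insertI2)
    qed (simp add: functional_0[OF jd] functional_1[OF jd])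
    have "B * T ^ n * A = (B - 1) * T ^ n * (A - 1) + (B - 1) * T ^ n + T ^ n * (A - 1) + T ^ n"
      by (simp add: algebra_simps)
    then show ?thesis
      by (simp add: functional_add[OF jd] z1 z2 z3 z4)
  qed
  have "\<phi> (E $ k) = 1 $ k" for k
  proof -
    have "(B * fps_geo T) $ j = (B * (\<Sum>n\<le>k. T ^ n)) $ j" if "j \<le> k" for j
      by (rule fps_mult_nth_cong) (use that in \<open>auto intro: fps_geo_nth[OF T0]\<close>)
    then have "E $ k = (B * (\<Sum>n\<le>k. T ^ n) * A) $ k"
      unfolding E_def by (rule fps_mult_nth_cong)
    also have "\<dots> = (\<Sum>n\<le>k. (B * T ^ n * A) $ k)"
      by (simp add: sum_distrib_left sum_distrib_right fps_sum_nth)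
    finally have "\<phi> (E $ k) = (\<Sum>n\<le>k. if n = 0 then 1 $ k else 0)"
      by (simp add: functional_sum[OF jd] pow)
    also have "\<dots> = 1 $ k"
      by (simp add: sum.delta)
    finally show ?thesis .
  qed
  then have "fps_functional \<phi> (resolv w (a + b)) = 1"
    by (simp add: fps_eq_iff flip: E)
  then have "w * (Abs_fps (\<lambda>n. \<phi> ((a + b) ^ n)) oo (fps_X * w)) = 1"
    by (simp add: resolv_def fps_functional_scal[OF jd] fps_functional_geo[OF jd])
  then show ?thesis
    using w0 by (simp add: inverts_moments_def a_def b_def w_def)
qed

section \<open>Compositional inverses of moment series\<close>

lemma moment_fps_compose:
  assumes "u $ 0 = (1 :: complex)"
  shows "(fps_X * Abs_fps m) oo (fps_X * u) = fps_X * (u * (Abs_fps m oo (fps_X * u)))"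
  by (simp add: fps_compose_mult_distrib fps_X_fps_compose_startby0 mult.assoc)

text \<open>Multiplied by t, the condition says that t u is a compositional inverse of t M(t), which
  is what \<open>fps_inv\<close> produces.\<close>

lemma inverts_moments_iff:
  "inverts_moments m u \<longleftrightarrow> u $ 0 = 1 \<and> (fps_X * Abs_fps m) oo (fps_X * u) = fps_X"
proof -
  have "fps_X * (u * (Abs_fps m oo (fps_X * u))) = fps_X \<longleftrightarrow>
        u * (Abs_fps m oo (fps_X * u)) = 1"
    using mult_left_cancel[of "fps_X :: complex fps" "u * (Abs_fps m oo (fps_X * u))" 1]
    by simp
  then show ?thesis
    by (auto simp: inverts_moments_def moment_fps_compose)
qed

lemma inverts_moments_exists:
  assumes "m 0 = 1"
  obtains u where "inverts_moments m u"
proof -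
  define Z where "Z = fps_inv (fps_X * Abs_fps m)"
  define u where "u = fps_shift 1 Z"
  have comp: "(fps_X * Abs_fps m) oo Z = fps_X"
    unfolding Z_def by (rule fps_inv_right) (simp_all add: assms)
  have Z0: "Z $ 0 = 0" by (simp add: Z_def fps_inv_def)
  have Z: "Z = fps_X * u"
    by (rule fps_ext) (auto simp: u_def Z0)
  have "((fps_X * Abs_fps m) oo Z) $ 1 = 1"
    by (simp add: comp)
  then have "u $ 0 = 1"
    by (simp add: fps_compose_nth assms Z)
  with comp show ?thesis
    by (intro that[of u]) (simp add: inverts_moments_iff Z)
qed

text \<open>The hypothesis is the Marchenko-Pastur equation for t M(t). Solving it for the argument
  shows what \<open>u\<close> must be: 1/u = 1 + t R(t) with the R-transform R(t) = b/(1 -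
  t).\<close>

lemma quadratic_inverts_moments:
  fixes b :: complex
  assumes m: "fps_X * Abs_fps m - (fps_X * Abs_fps m)\<^sup>2 = fps_X * (1 + fps_const (b - 1) * (fps_X * Abs_fps m))"
  shows "inverts_moments m (inverse (1 + fps_const b * fps_X * inverse (1 - fps_X)))"
proof -
  define D :: "complex fps" where "D = 1 - fps_X"
  define u where "u = inverse (1 + fps_const b * fps_X * inverse D)"
  define P where "P = (fps_X * Abs_fps m) oo (fps_X * u)"
  have u0: "u $ 0 = 1" by (simp add: u_def D_def)
  have uD: "u * (D + fps_const b * fps_X) = D"
  proof -
    have "u * (1 + fps_const b * fps_X * inverse D) = 1"
      unfolding u_def by (rule inverse_mult_eq_1) (simp add: D_def)
    moreover have "inverse D * D = 1"
      by (rule inverse_mult_eq_1) (simp add: D_def)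
    ultimately have "u * (1 + fps_const b * fps_X * inverse D) * D = D"
      by simp
    moreover have "u * (1 + fps_const b * fps_X * inverse D) * D = u * (D + fps_const b * fps_X * (inverse D * D))"
      by (simp add: algebra_simps)
    ultimately show ?thesis using \<open>inverse D * D = 1\<close> by simp
  qed
  have Xu0: "(fps_X * u) $ 0 = 0" by simp
  have "(fps_X * Abs_fps m - (fps_X * Abs_fps m)\<^sup>2) oo (fps_X * u)
      = (fps_X * (1 + fps_const (b - 1) * (fps_X * Abs_fps m))) oo (fps_X * u)"
    by (simp only: m)
  then have P: "P - P\<^sup>2 = fps_X * u * (1 + fps_const (b - 1) * P)"
    by (simp only: fps_compose_sub_distrib fps_compose_add_distrib fps_compose_mult_distrib[OF Xu0]
        power2_eq_square fps_X_fps_compose_startby0[OF Xu0] fps_const_compose fps_compose_1 P_def)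
  have "fps_X * D = fps_X * (u * (D + fps_const b * fps_X))"
    by (simp only: uD)
  also have "D + fps_const b * fps_X = 1 + fps_const (b - 1) * fps_X"
    by (simp add: D_def algebra_simps flip: fps_const_sub)
  finally have X: "fps_X - fps_X\<^sup>2 = fps_X * u * (1 + fps_const (b - 1) * fps_X)"
    by (simp add: D_def algebra_simps power2_eq_square)
  \<comment> \<open>\<open>P\<close> and \<open>fps_X\<close> satisfy the same quadratic equation.
    The difference of the two equations factors, and the second factor has constant coefficient 1,
    so it cannot vanish.\<close>
  have "(P - fps_X) * (1 - P - fps_X - fps_X * u * fps_const (b - 1))
      = (P - P\<^sup>2 - fps_X * u * (1 + fps_const (b - 1) * P))
        - (fps_X - fps_X\<^sup>2 - fps_X * u * (1 + fps_const (b - 1) * fps_X))"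
    by (simp add: algebra_simps power2_eq_square)
  also have "\<dots> = 0"
    by (simp only: P X) simp
  finally have "P - fps_X = 0 \<or> 1 - P - fps_X - fps_X * u * fps_const (b - 1) = 0"
    by simp
  moreover have "(1 - P - fps_X - fps_X * u * fps_const (b - 1)) $ 0 = 1"
    by (simp add: P_def)
  ultimately have "P = fps_X"
    by (metis eq_iff_diff_eq_0 fps_zero_nth zero_neq_one)
  then show ?thesis
    using u0 unfolding inverts_moments_iff P_def u_def D_def by simp
qed

text \<open>The equation for \<open>Y\<close> reads \<open>1 / Y = 1 / X - \<beta> / (1 - \<psi>)\<close>: it is the
  subordination relation \<open>G\<^sub>\<rho>(z) = G\<^sub>\<nu>(z - \<beta> / (1 + G\<^sub>\<rho>(z)))\<close> at
  \<open>X = 1 / z\<close>, where \<open>\<psi> = - G\<^sub>\<rho>(1 / X)\<close>.\<close>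

lemma formal_subordination:
  fixes b :: complex
  defines "\<psi> m \<equiv> fps_X * Abs_fps m"
  assumes jd: "joint_distribution \<phi>" and free: "free_pair \<phi>"
    and ma: "\<And>n. \<phi> (nc_var False ^ n) = ma n" and mb: "\<And>n. \<phi> (nc_var True ^ n) = mb n"
    and mc: "\<And>n. \<phi> ((nc_var False + nc_var True) ^ n) = mc n"
    and quad: "\<psi> ma - (\<psi> ma)\<^sup>2 = fps_X * (1 + fps_const (b - 1) * \<psi> ma)"
  obtains Y where "Y $ 0 = 0" "\<psi> mb oo Y = \<psi> mc"
    "(1 - \<psi> mc) * Y = (1 - \<psi> mc) * fps_X + fps_const b * Y * fps_X"
proof -
  have "mb 0 = 1" "mc 0 = 1"
    using mb[of 0] mc[of 0] functional_1[OF jd] by simp_all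
  obtain v where v: "inverts_moments mb v"
    using inverts_moments_exists \<open>mb 0 = 1\<close> by blast
  define D :: "complex fps" where "D = 1 - fps_X"
  define u where "u = inverse (1 + fps_const b * fps_X * inverse D)"
  have u: "inverts_moments ma u"
    unfolding u_def D_def by (rule quadratic_inverts_moments) (use quad in \<open>simp add: \<psi>_def\<close>)
  define w where "w = inverse (inverse u + inverse v - 1)"
  have w: "inverts_moments mc w"
    using free_sum_inverts_moments[OF jd free, of u v] u v by (simp add: ma mb mc w_def)
  have v0: "v $ 0 = 1" and w0: "w $ 0 = 1"
    using v w by (simp_all add: inverts_moments_def)
  have winv: "inverse w = inverse v + fps_const b * fps_X * inverse D"
  proof -
    have "inverse w = inverse u + inverse v - 1"
      unfolding w_def using u v by (intro fps_inverse_idempotent) (simp add: inverts_moments_def)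
    also have "inverse u = 1 + fps_const b * fps_X * inverse D"
      unfolding u_def by (rule fps_inverse_idempotent) (simp add: D_def)
    finally show ?thesis by simp
  qed
  have one: "inverse w * w = 1" "inverse v * v = 1" "inverse D * D = 1"
    by (auto intro!: inverse_mult_eq_1 simp: v0 w0 D_def)
  have "D * v * (inverse w * w) = D * v * w * inverse w"
    by (simp add: mult_ac)
  also have "\<dots> = D * w * (inverse v * v) + fps_const b * fps_X * v * w * (inverse D * D)"
    by (simp add: winv algebra_simps)
  finally have vw: "D * v = D * w + fps_const b * fps_X * v * w"
    by (simp add: one)
  define Xb where "Xb = fps_X * v"
  define Xc where "Xc = fps_X * w"
  have Xb0: "Xb $ 0 = 0" and Xc0: "Xc $ 0 = 0" by (simp_all add: Xb_def Xc_def)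
  \<comment> \<open>Divided by D Xb Xc this reads 1/Xc = 1/Xb + b/(1 - t): the functional inverses
    of the two transforms differ by the R-transform of the first variable.\<close>
  have rel: "D * Xb = D * Xc + fps_const b * Xb * Xc"
  proof -
    have "fps_X * (D * v) = fps_X * (D * w + fps_const b * fps_X * v * w)"
      by (simp only: vw)
    then show ?thesis by (simp add: Xb_def Xc_def algebra_simps)
  qed
  have \<psi>b: "\<psi> mb oo Xb = fps_X" and \<psi>c: "\<psi> mc oo Xc = fps_X"
    using v w by (simp_all add: inverts_moments_iff Xb_def Xc_def \<psi>_def)
  have c0: "\<psi> mc $ 0 = 0" and c1: "\<psi> mc $ 1 = 1"
    by (simp_all add: \<psi>_def \<open>mc 0 = 1\<close>)
  have inv: "Xc oo \<psi> mc = fps_X"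
  proof -
    have "fps_inv (\<psi> mc) oo (\<psi> mc oo Xc) = (fps_inv (\<psi> mc) oo \<psi> mc) oo Xc"
      by (rule fps_compose_assoc) (simp_all add: Xc0 c0)
    then have "fps_inv (\<psi> mc) = Xc"
      using c0 c1 by (simp add: \<psi>c fps_inv fps_X_fps_compose_startby0 Xc0)
    then show ?thesis
      using fps_inv[of "\<psi> mc"] c0 c1 by simp
  qed
  \<comment> \<open>\<open>Xb\<close> evaluated at the transform of the sum: at X = 1/z this is 1 /
    \<omega>(z).\<close>
  define Y where "Y = Xb oo \<psi> mc"
  show ?thesis
  proof
    show "Y $ 0 = 0" by (simp add: Y_def Xb0)
    have "\<psi> mb oo Y = (\<psi> mb oo Xb) oo \<psi> mc"
      unfolding Y_def by (rule fps_compose_assoc) (simp_all add: Xb0 c0)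
    then show "\<psi> mb oo Y = \<psi> mc"
      by (simp add: \<psi>b fps_X_fps_compose_startby0 c0)
    have "(D * Xb) oo \<psi> mc = (D * Xc + fps_const b * Xb * Xc) oo \<psi> mc"
      by (simp only: rel)
    then show "(1 - \<psi> mc) * Y = (1 - \<psi> mc) * fps_X + fps_const b * Y * fps_X"
      by (simp only: D_def fps_compose_sub_distrib fps_compose_add_distrib fps_compose_mult_distrib[OF c0]
          fps_X_fps_compose_startby0[OF c0] fps_const_compose fps_compose_1 inv Y_def)
  qed
qed

section \<open>Compactly supported laws\<close>

lemma ln_one_minus_bound:
  assumes "\<bar>u\<bar> \<le> 1 / 2"
  shows "\<bar>ln (1 - u)\<bar> \<le> 2 * \<bar>u :: real\<bar>"
proof -
  have "\<bar>ln (1 + (- u)) - (- u)\<bar> \<le> 2 * (- u)\<^sup>2"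
    by (rule abs_ln_one_plus_x_minus_x_bound) (use assms in simp)
  moreover have "2 * (- u)\<^sup>2 \<le> \<bar>u\<bar>"
  proof -
    have "2 * (- u)\<^sup>2 = (2 * \<bar>u\<bar>) * \<bar>u\<bar>"
      by (simp add: power2_eq_square)
    also have "\<dots> \<le> 1 * \<bar>u\<bar>"
      using assms by (intro mult_right_mono) auto
    finally show ?thesis by simp
  qed
  ultimately show ?thesis by (simp add: abs_if split: if_splits)
qed

text \<open>\<open>s\<close> is any lower bound of the law, not necessarily the end of its support:
  the Marchenko-Pastur law is used with s = 0. Where the true end matters, positive mass next to it
  is a separate assumption.\<close>

locale bounded_law = prob_space M for M :: "real measure" +
  fixes s B :: real
  assumes sets_eq [measurable_cong]: "sets M = sets borel"
    and lower: "AE x in M. s \<le> x"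
    and upper: "AE x in M. \<bar>x\<bar> \<le> B"
begin

text \<open>Polymorphic in the field, so that one differentiation lemma covers both real and complex
  arguments.\<close>

definition G :: "'a \<Rightarrow> 'a :: {real_normed_field, banach, second_countable_topology}" where
  "G z = (\<integral>x. 1 / (of_real x - z) \<partial>M)"

lemma integral_pos:
  fixes f :: "real \<Rightarrow> real"
  assumes "integrable M f" "AE x in M. f x > 0"
  shows "(\<integral>x. f x \<partial>M) > 0"
  using integral_less_AE_space[of "\<lambda>_. 0" f] assms by (simp add: emeasure_space_1)

text \<open>A quadratic Taylor remainder that is uniform in x integrates to at most C |h|^2, as the
  total mass is 1. The transform and the logarithmic integral both fit this form.\<close>

lemma has_field_derivative_integral:
  fixes f :: "real \<Rightarrow> 'a \<Rightarrow> 'a::{real_normed_field, banach, second_countable_topology}"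
  assumes "\<delta> > 0" and f: "\<And>h. norm h < \<delta> \<Longrightarrow> integrable M (\<lambda>x. f x (z + h))" and f': "integrable M f'"
    and C: "AE x in M. \<forall>h. norm h < \<delta> \<longrightarrow> norm (f x (z + h) - f x z - h * f' x) \<le> C * (norm h)\<^sup>2"
  shows "((\<lambda>w. \<integral>x. f x w \<partial>M) has_field_derivative (\<integral>x. f' x \<partial>M)) (at z)"
proof -
  let ?F = "\<lambda>w. \<integral>x. f x w \<partial>M" and ?D = "\<integral>x. f' x \<partial>M"
  have bd: "norm ((?F (z + h) - ?F z) / h - ?D) \<le> C * norm h" if h: "norm h < \<delta>" "h \<noteq> 0" for h
  proof -
    have i: "integrable M (\<lambda>x. f x (z + h))" "integrable M (\<lambda>x. f x z)"
      using f[of h] f[of 0] h \<open>\<delta> > 0\<close> by auto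
    have "?F (z + h) - ?F z - h * ?D = (\<integral>x. f x (z + h) - f x z - h * f' x \<partial>M)"
      using i f' by simp
    also have "norm \<dots> \<le> (\<integral>x. norm (f x (z + h) - f x z - h * f' x) \<partial>M)"
      by (rule integral_norm_bound)
    also have "\<dots> \<le> C * (norm h)\<^sup>2"
    proof (rule integral_le_const)
      show "integrable M (\<lambda>x. norm (f x (z + h) - f x z - h * f' x))"
        using i f' by simp
      show "AE x in M. norm (f x (z + h) - f x z - h * f' x) \<le> C * (norm h)\<^sup>2"
        using C by eventually_elim (use h in auto)
    qed
    finally have *: "norm (?F (z + h) - ?F z - h * ?D) \<le> C * (norm h)\<^sup>2" .
    have "(?F (z + h) - ?F z) / h - ?D = (?F (z + h) - ?F z - h * ?D) / h"
      using h by (simp add: field_simps)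
    then have "norm ((?F (z + h) - ?F z) / h - ?D) = norm (?F (z + h) - ?F z - h * ?D) / norm h"
      by (simp add: norm_divide)
    also have "\<dots> \<le> C * (norm h)\<^sup>2 / norm h"
      using * by (simp add: divide_right_mono)
    finally show ?thesis using h by (simp add: power2_eq_square)
  qed
  have "((\<lambda>h. (?F (z + h) - ?F z) / h - ?D) \<longlongrightarrow> 0) (at 0)"
  proof (rule Lim_null_comparison)
    show "\<forall>\<^sub>F h in at 0. norm ((?F (z + h) - ?F z) / h - ?D) \<le> C * norm h"
      unfolding eventually_at using bd \<open>\<delta> > 0\<close> by (intro exI[of _ \<delta>]) (auto simp: dist_norm)
    have "((\<lambda>h::'a. C * norm h) \<longlongrightarrow> C * norm (0::'a)) (at 0)"
      by (intro tendsto_intros)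
    then show "((\<lambda>h::'a. C * norm h) \<longlongrightarrow> 0) (at 0)" by simp
  qed
  then show ?thesis
    unfolding DERIV_def by (rule LIM_zero_cancel)
qed

lemma integrable_inverse_power:
  fixes z :: "'a::{real_normed_field, banach, second_countable_topology}"
  assumes "d > 0" "AE x in M. d \<le> norm (of_real x - z)"
  shows "integrable M (\<lambda>x. 1 / (of_real x - z) ^ k)"
proof (rule integrable_const_bound)
  show "AE x in M. norm (1 / (of_real x - z) ^ k) \<le> 1 / d ^ k"
    using assms(2)
  proof eventually_elim
    case (elim x)
    have "0 < norm (of_real x - z)" using elim \<open>d > 0\<close> by linarith
    then have "1 / norm (of_real x - z) ^ k \<le> 1 / d ^ k"
      using elim \<open>d > 0\<close> by (intro divide_left_mono power_mono mult_pos_pos zero_less_power) auto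
    then show ?case by (simp add: norm_divide norm_power)
  qed
qed measurable

lemma has_field_derivative_G:
  fixes z :: "'a::{real_normed_field, banach, second_countable_topology}"
  assumes d: "d > 0" "AE x in M. d \<le> norm (of_real x - z)"
  shows "(G has_field_derivative (\<integral>x. 1 / (of_real x - z)\<^sup>2 \<partial>M)) (at z)"
  unfolding G_def
proof (rule has_field_derivative_integral)
  show "d / 2 > 0" using d by simp
  have ge: "d / 2 \<le> norm (of_real x - (z + h))" if "d \<le> norm (of_real x - z)" "norm h < d / 2" for x h
    using norm_triangle_ineq2[of "of_real x - z" h] that by (simp add: diff_diff_eq)
  show "integrable M (\<lambda>x. 1 / (of_real x - (z + h)))" if "norm h < d / 2" for h
  proof -
    have "AE x in M. d / 2 \<le> norm (of_real x - (z + h))"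
      using d(2) by eventually_elim (use ge that in auto)
    then show ?thesis
      using integrable_inverse_power[of "d / 2" "z + h" 1] d by simp
  qed
  show "integrable M (\<lambda>x. 1 / (of_real x - z)\<^sup>2)"
    by (rule integrable_inverse_power[OF d])
  \<comment> \<open>With y = x - z the remainder is exactly h^2 / (y^2 (y - h)); |y| \<ge> d and |y
    - h| \<ge> d/2 give the constant 2 / d^3.\<close>
  show "AE x in M. \<forall>h. norm h < d / 2 \<longrightarrow>
      norm (1 / (of_real x - (z + h)) - 1 / (of_real x - z) - h * (1 / (of_real x - z)\<^sup>2)) \<le> (2 / d ^ 3) * (norm h)\<^sup>2"
    using d(2)
  proof (eventually_elim, intro allI impI)
    fix x and h :: 'a
    assume x: "d \<le> norm (of_real x - z)" and h: "norm h < d / 2"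
    define y where "y = of_real x - z"
    have y: "d \<le> norm y" "d / 2 \<le> norm (y - h)"
      using x ge[OF x h] by (simp_all add: y_def diff_diff_eq)
    then have nz: "y \<noteq> 0" "y - h \<noteq> 0" using d by auto
    have "1 / (y - h) - 1 / y - h * (1 / y\<^sup>2) = h\<^sup>2 / (y\<^sup>2 * (y - h))"
    proof -
      have "(1 / (y - h) - 1 / y - h * (1 / y\<^sup>2)) * (y\<^sup>2 * (y - h)) = h\<^sup>2"
        using nz by (simp add: field_simps power2_eq_square)
      then show ?thesis using nz by (simp add: nonzero_eq_divide_eq)
    qed
    then have "norm (1 / (y - h) - 1 / y - h * (1 / y\<^sup>2)) = (norm h)\<^sup>2 / ((norm y)\<^sup>2 * norm (y - h))"
      by (simp add: norm_divide norm_mult norm_power)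
    also have "\<dots> \<le> (norm h)\<^sup>2 / (d\<^sup>2 * (d / 2))"
      using y d by (intro divide_left_mono mult_mono power_mono mult_pos_pos) auto
    also have "\<dots> = (2 / d ^ 3) * (norm h)\<^sup>2"
      by (simp add: power2_eq_square power3_eq_cube)
    finally show "norm (1 / (of_real x - (z + h)) - 1 / (of_real x - z) - h * (1 / (of_real x - z)\<^sup>2)) \<le> (2 / d ^ 3) * (norm h)\<^sup>2"
      by (simp add: y_def diff_diff_eq)
  qed
qed

subsection \<open>The Stieltjes transform on the real half-line\<close>

lemma G_real: "G z = stieltjes M z"
  by (simp add: G_def stieltjes_def)

lemma G_of_real: "G (of_real z :: complex) = of_real (stieltjes M z)"
proof -
  have "(\<lambda>x. 1 / (of_real x - of_real z :: complex)) = (\<lambda>x. of_real (1 / (x - z)))"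
    by simp
  then show ?thesis
    unfolding G_def stieltjes_def by (simp only: integral_complex_of_real)
qed

lemma dist_real: "AE x in M. s - z \<le> norm (of_real x - z :: real)"
  using lower by eventually_elim auto

lemma integrable_real_inverse_power:
  assumes "z < s"
  shows "integrable M (\<lambda>x. 1 / (x - z) ^ k)"
  using integrable_inverse_power[of "s - z" z k] dist_real[of z] assms by simp

lemma stieltjes_pos:
  assumes "z < s"
  shows "stieltjes M z > 0"
  unfolding stieltjes_def
proof (rule integral_pos)
  show "integrable M (\<lambda>x. 1 / (x - z))"
    using integrable_real_inverse_power[OF assms, of 1] by simp
  show "AE x in M. 1 / (x - z) > 0"
    using lower by eventually_elim (use assms in auto)
qed

lemma stieltjes_le:
  assumes "z < s"
  shows "stieltjes M z \<le> 1 / (s - z)"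
  unfolding stieltjes_def
proof (rule integral_le_const)
  show "integrable M (\<lambda>x. 1 / (x - z))"
    using integrable_real_inverse_power[OF assms, of 1] by simp
  show "AE x in M. 1 / (x - z) \<le> 1 / (s - z)"
    using lower by eventually_elim (use assms in \<open>auto intro!: divide_left_mono\<close>)
qed

lemma stieltjes_deriv:
  assumes "z < s"
  obtains D where "D > 0" "(stieltjes M has_real_derivative D) (at z)"
proof
  show "(\<integral>x. 1 / (x - z)\<^sup>2 \<partial>M) > 0"
  proof (rule integral_pos[OF integrable_real_inverse_power[OF assms]])
    show "AE x in M. 1 / (x - z)\<^sup>2 > 0"
      using lower by eventually_elim (use assms in auto)
  qed
  have "G = stieltjes M" by (rule ext) (simp add: G_real)
  then show "(stieltjes M has_real_derivative (\<integral>x. 1 / (x - z)\<^sup>2 \<partial>M)) (at z)"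
    using has_field_derivative_G[of "s - z" z] dist_real[of z] assms by simp
qed

lemma continuous_stieltjes: "z < s \<Longrightarrow> isCont (stieltjes M) z"
  by (metis stieltjes_deriv DERIV_isCont)

lemma stieltjes_strict_mono:
  assumes "x < y" "y < s"
  shows "stieltjes M x < stieltjes M y"
proof (rule DERIV_pos_imp_increasing[OF assms(1)])
  fix z assume "x \<le> z" "z \<le> y"
  then have "z < s" using assms by simp
  then show "\<exists>D. (stieltjes M has_real_derivative D) (at z) \<and> D > 0"
    using stieltjes_deriv by blast
qed

lemma stieltjes_mono_iff:
  assumes "x < s" "y < s"
  shows "stieltjes M x < stieltjes M y \<longleftrightarrow> x < y"
  using assms stieltjes_strict_mono[of x y] stieltjes_strict_mono[of y x] by (metis linorder_cases less_asym)

lemma stieltjes_tendsto_0: "(stieltjes M \<longlongrightarrow> 0) at_bot"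
proof (rule tendsto_sandwich)
  show "\<forall>\<^sub>F z in at_bot. 0 \<le> stieltjes M z"
    using eventually_gt_at_bot[of s] by eventually_elim (simp add: stieltjes_pos less_imp_le)
  show "\<forall>\<^sub>F z in at_bot. stieltjes M z \<le> 1 / (s - z)"
    using eventually_gt_at_bot[of s] by eventually_elim (rule stieltjes_le)
  show "((\<lambda>z. 1 / (s - z)) \<longlongrightarrow> 0) at_bot" by real_asymp
qed simp

subsection \<open>The Stieltjes transform on a complex half-plane\<close>

lemma dist_complex: "AE x in M. s - Re z \<le> norm (of_real x - z :: complex)"
  using lower
proof eventually_elim
  case (elim x)
  then show ?case
    using complex_Re_le_cmod[of "of_real x - z"] by simp
qed

lemma dist_complex_Im: "AE x in M. \<bar>Im z\<bar> \<le> norm (of_real x - z :: complex)"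
  using abs_Im_le_cmod[of "of_real _ - z"] by simp

lemma holomorphic_G: "G holomorphic_on {z :: complex. Re z < s \<or> Im z \<noteq> 0}"
proof (rule holomorphic_onI)
  fix z :: complex assume "z \<in> {z. Re z < s \<or> Im z \<noteq> 0}"
  then have "0 < s - Re z \<or> 0 < \<bar>Im z\<bar>" by auto
  then obtain D where "(G has_field_derivative D) (at z)"
    using has_field_derivative_G[OF _ dist_complex[of z]] has_field_derivative_G[OF _ dist_complex_Im[of z]]
    by blast
  then show "G field_differentiable (at z within {z. Re z < s \<or> Im z \<noteq> 0})"
    using field_differentiable_def field_differentiable_at_within by blast
qed

lemma G_deriv_of_real:
  assumes "z < s"
  obtains D where "D > 0" "(G has_field_derivative complex_of_real D) (at (of_real z))"
proof
  show "(\<integral>x. 1 / (x - z)\<^sup>2 \<partial>M) > 0"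
  proof (rule integral_pos[OF integrable_real_inverse_power[OF assms]])
    show "AE x in M. 1 / (x - z)\<^sup>2 > 0"
      using lower by eventually_elim (use assms in auto)
  qed
  have "(\<lambda>x. 1 / (of_real x - of_real z :: complex)\<^sup>2) = (\<lambda>x. of_real (1 / (x - z)\<^sup>2))"
    by simp
  then have "(\<integral>x. 1 / (of_real x - of_real z :: complex)\<^sup>2 \<partial>M) = of_real (\<integral>x. 1 / (x - z)\<^sup>2 \<partial>M)"
    by (simp only: integral_complex_of_real)
  moreover have "(G has_field_derivative (\<integral>x. 1 / (of_real x - of_real z :: complex)\<^sup>2 \<partial>M)) (at (of_real z))"
    by (rule has_field_derivative_G[OF _ dist_complex]) (use assms in simp)
  ultimately show "(G has_field_derivative complex_of_real (\<integral>x. 1 / (x - z)\<^sup>2 \<partial>M)) (at (of_real z))"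
    by simp
qed

text \<open>The integrand 1/(x - z) has real part (x - Re z) / |x - z|^2 and imaginary part Im z /
  |x - z|^2; each keeps a fixed sign for x \<ge> s.\<close>

lemma
  assumes z: "Re z < s"
  shows Re_G_pos: "Re (G z) > 0"
    and Im_G: "Im z > 0 \<Longrightarrow> Im (G z) > 0" "Im z < 0 \<Longrightarrow> Im (G z) < 0"
proof -
  have int: "integrable M (\<lambda>x. 1 / (of_real x - z))"
    using integrable_inverse_power[of "s - Re z" z 1] dist_complex[of z] z by simp
  have Re: "Re (G z) = (\<integral>x. Re (1 / (of_real x - z)) \<partial>M)" and Im: "Im (G z) = (\<integral>x. Im (1 / (of_real x - z)) \<partial>M)"
    unfolding G_def using int by (simp_all only: integral_Re integral_Im)
  have intR: "integrable M (\<lambda>x. Re (1 / (of_real x - z)))" and intI: "integrable M (\<lambda>x. Im (1 / (of_real x - z)))"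
    using int by (intro integrable_Re integrable_Im; simp)+
  have sq: "(x - Re z)\<^sup>2 + (Im z)\<^sup>2 > 0" if "s \<le> x" for x
    using that z by (simp add: add_pos_nonneg)
  show "Re (G z) > 0"
    unfolding Re
  proof (rule integral_pos[OF intR])
    show "AE x in M. 0 < Re (1 / (of_real x - z))"
      using lower by eventually_elim (use z sq in \<open>auto simp: Re_divide intro!: divide_pos_pos\<close>)
  qed
  show "Im (G z) > 0" if "Im z > 0"
    unfolding Im
  proof (rule integral_pos[OF intI])
    show "AE x in M. 0 < Im (1 / (of_real x - z))"
      using lower by eventually_elim (use z sq that in \<open>auto simp: Im_divide intro!: divide_pos_pos\<close>)
  qed
  have "(\<integral>x. - Im (1 / (of_real x - z)) \<partial>M) > 0" if "Im z < 0"
  proof (rule integral_pos)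
    show "integrable M (\<lambda>x. - Im (1 / (of_real x - z)))" using intI by simp
    show "AE x in M. 0 < - Im (1 / (of_real x - z))"
      using lower by eventually_elim (use z sq that in \<open>auto simp: Im_divide divide_neg_pos\<close>)
  qed
  then show "Im (G z) < 0" if "Im z < 0"
    using that unfolding Im by simp
qed

subsection \<open>Power series expansions\<close>

text \<open>The common source of two expansions: at infinity with k = 1 and r = t x, and around a
  real w < s with k = 1/(x - w) and r = (z - w)/(x - w).\<close>

lemma sums_integral_geometric:
  fixes k r :: "real \<Rightarrow> 'a::{real_normed_field, banach, second_countable_topology}"
  assumes [measurable]: "k \<in> borel_measurable borel" "r \<in> borel_measurable borel"
    and "q < 1" and k: "AE x in M. norm (k x) \<le> K" and r: "AE x in M. norm (r x) \<le> q"
  shows "(\<lambda>n. \<integral>x. k x * r x ^ n \<partial>M) sums (\<integral>x. k x / (1 - r x) \<partial>M)"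
proof -
  have "AE x in M. 0 \<le> q \<and> 0 \<le> K"
    using r k by eventually_elim (metis norm_ge_zero order_trans)
  then have q: "0 \<le> q" and K: "0 \<le> K" by auto
  have bd: "AE x in M. norm (k x * r x ^ n) \<le> K * q ^ n" for n
    using r k by eventually_elim (auto simp: norm_mult norm_power q K intro!: mult_mono power_mono)
  have int: "integrable M (\<lambda>x. k x * r x ^ n)" for n
    by (rule integrable_const_bound[OF bd]) measurable
  have "(\<lambda>n. \<integral>x. k x * r x ^ n \<partial>M) sums (\<integral>x. suminf (\<lambda>n. k x * r x ^ n) \<partial>M)"
  proof (rule sums_integral[OF int])
    show "AE x in M. summable (\<lambda>n. norm (k x * r x ^ n))"
      using r
    proof eventually_elim
      case (elim x)
      then have "summable (\<lambda>n. norm (k x) * norm (r x) ^ n)"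
        using \<open>q < 1\<close> by (intro summable_mult summable_geometric) simp
      then show ?case by (simp add: norm_mult norm_power)
    qed
    show "summable (\<lambda>n. \<integral>x. norm (k x * r x ^ n) \<partial>M)"
    proof (rule summable_comparison_test)
      have "(\<integral>x. norm (k x * r x ^ n) \<partial>M) \<le> K * q ^ n" for n
        using int bd by (intro integral_le_const) auto
      then show "\<exists>N. \<forall>n\<ge>N. norm (\<integral>x. norm (k x * r x ^ n) \<partial>M) \<le> K * q ^ n"
        by auto
      show "summable (\<lambda>n. K * q ^ n)"
        using \<open>q < 1\<close> q by (intro summable_mult summable_geometric) simp
    qed
  qed
  also have "(\<integral>x. suminf (\<lambda>n. k x * r x ^ n) \<partial>M) = (\<integral>x. k x / (1 - r x) \<partial>M)"
  proof (rule integral_cong_AE)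
    show "AE x in M. suminf (\<lambda>n. k x * r x ^ n) = k x / (1 - r x)"
      using r
    proof eventually_elim
      case (elim x)
      then have "(\<lambda>n. k x * r x ^ n) sums (k x * (1 / (1 - r x)))"
        using \<open>q < 1\<close> by (intro sums_mult geometric_sums) simp
      then show ?case by (simp add: sums_iff)
    qed
  qed measurable
  finally show ?thesis .
qed

lemma moments_sums:
  fixes t :: complex
  assumes "norm t * B < 1"
  shows "(\<lambda>n. of_real (\<integral>x. x ^ n \<partial>M) * t ^ n) sums (\<integral>x. 1 / (1 - t * of_real x) \<partial>M)"
proof -
  have "(\<lambda>n. \<integral>x. 1 * (t * of_real x) ^ n \<partial>M) sums (\<integral>x. 1 / (1 - t * of_real x) \<partial>M)"
  proof (rule sums_integral_geometric[OF _ _ assms])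
    show "AE x in M. norm (1 :: complex) \<le> 1" by simp
    show "AE x in M. norm (t * of_real x) \<le> norm t * B"
      using upper by eventually_elim (auto simp: norm_mult intro!: mult_left_mono)
  qed measurable
  moreover have "(\<integral>x. 1 * (t * of_real x) ^ n \<partial>M) = of_real (\<integral>x. x ^ n \<partial>M) * t ^ n" for n
    by (simp add: power_mult_distrib mult.commute flip: of_real_power)
  ultimately show ?thesis by simp
qed

text \<open>Taylor expansion about a real point, on the disc that touches \<open>s\<close>. Its
  coefficients are integrals of positive functions, which is what later forces the singularity at
  the end of the support.\<close>

lemma G_sums:
  fixes z :: complex
  assumes "w < s" "norm (z - of_real w) < s - w"
  shows "(\<lambda>n. of_real (\<integral>x. 1 / (x - w) ^ Suc n \<partial>M) * (z - of_real w) ^ n) sums G z"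
proof -
  let ?u = "z - of_real w"
  have "(\<lambda>n. \<integral>x. of_real (1 / (x - w)) * (?u / of_real (x - w)) ^ n \<partial>M) sums
      (\<integral>x. of_real (1 / (x - w)) / (1 - ?u / of_real (x - w)) \<partial>M)"
  proof (rule sums_integral_geometric)
    show "norm ?u / (s - w) < 1" using assms by simp
    show "AE x in M. norm (complex_of_real (1 / (x - w))) \<le> 1 / (s - w)"
      unfolding norm_of_real
      using lower by eventually_elim (use assms in \<open>auto intro!: divide_left_mono mult_pos_pos\<close>)
    show "AE x in M. norm (?u / of_real (x - w)) \<le> norm ?u / (s - w)"
      unfolding norm_divide norm_of_real
      using lower by eventually_elim (use assms in \<open>auto intro!: divide_left_mono mult_pos_pos\<close>)
  qed measurable
  moreover have "(\<integral>x. of_real (1 / (x - w)) / (1 - ?u / of_real (x - w)) \<partial>M) = G z"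
    unfolding G_def
  proof (rule integral_cong_AE)
    show "AE x in M. of_real (1 / (x - w)) / (1 - ?u / of_real (x - w)) = 1 / (of_real x - z)"
      using lower
    proof eventually_elim
      case (elim x)
      define y where "y = complex_of_real (x - w)"
      have "norm ?u < norm y"
        using elim assms unfolding y_def norm_of_real by linarith
      then have nz: "y \<noteq> 0" "y - ?u \<noteq> 0" by auto
      have "1 / y / (1 - ?u / y) = 1 / (y - ?u)"
        using nz by (simp add: divide_simps)
      moreover have "y - ?u = of_real x - z" by (simp add: y_def)
      ultimately show ?case by (simp add: y_def)
    qed
  qed measurable
  moreover have "(\<integral>x. of_real (1 / (x - w)) * (?u / of_real (x - w)) ^ n \<partial>M)
      = of_real (\<integral>x. 1 / (x - w) ^ Suc n \<partial>M) * ?u ^ n" for n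
  proof -
    have "(\<integral>x. of_real (1 / (x - w)) * (?u / of_real (x - w)) ^ n \<partial>M)
        = (\<integral>x. of_real (1 / (x - w) ^ Suc n) * ?u ^ n \<partial>M)"
      by (simp add: power_divide)
    also have "\<dots> = (\<integral>x. of_real (1 / (x - w) ^ Suc n) \<partial>M) * ?u ^ n"
      by (rule integral_mult_left_zero)
    finally show ?thesis by (simp only: integral_complex_of_real)
  qed
  ultimately show ?thesis by simp
qed

subsection \<open>The logarithmic potential\<close>

lemma integrable_ln:
  assumes "z < s"
  shows "integrable M (\<lambda>x. ln (x - z))"
proof (rule integrable_const_bound)
  show "AE x in M. norm (ln (x - z)) \<le> \<bar>ln (s - z)\<bar> + \<bar>ln (B - z)\<bar>"
    using lower upper
  proof eventually_elim
    case (elim x)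
    then have "ln (s - z) \<le> ln (x - z)" "ln (x - z) \<le> ln (B - z)"
      using assms by (auto intro!: ln_mono)
    then show ?case by auto
  qed
qed measurable

lemma log_potential_below:
  assumes "z < s"
  shows "log_potential M z = (\<integral>x. ln (x - z) \<partial>M)"
  unfolding log_potential_def
proof (rule integral_cong_AE)
  show "AE x in M. ln \<bar>z - x\<bar> = ln (x - z)"
    using lower by eventually_elim (use assms in \<open>auto simp: abs_if\<close>)
qed measurable

lemma ln_integral_deriv:
  assumes z: "z < s"
  shows "((\<lambda>z. \<integral>x. ln (x - z) \<partial>M) has_real_derivative - stieltjes M z) (at z)"
proof -
  define d where "d = s - z"
  have d: "d > 0" using z by (simp add: d_def)
  have "((\<lambda>z. \<integral>x. ln (x - z) \<partial>M) has_real_derivative (\<integral>x. - (1 / (x - z)) \<partial>M)) (at z)"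
  proof (rule has_field_derivative_integral)
    show "d / 2 > 0" using d by simp
    show "integrable M (\<lambda>x. ln (x - (z + h)))" if "norm h < d / 2" for h
      by (rule integrable_ln) (use that d in \<open>auto simp: d_def\<close>)
    show "integrable M (\<lambda>x. - (1 / (x - z)))"
      using integrable_real_inverse_power[OF z, of 1] by simp
    show "AE x in M. \<forall>h. norm h < d / 2 \<longrightarrow>
        norm (ln (x - (z + h)) - ln (x - z) - h * - (1 / (x - z))) \<le> (2 / d\<^sup>2) * (norm h)\<^sup>2"
      using lower
    proof (eventually_elim, intro allI impI)
      fix x h :: real
      assume x: "s \<le> x" and h: "norm h < d / 2"
      define y where "y = x - z"
      have y: "d \<le> y" using x by (simp add: y_def d_def)
      define u where "u = - h / y"
      have "\<bar>h\<bar> / y \<le> (d / 2) / d"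
        using y h d by (intro frac_le) auto
      then have u: "\<bar>u\<bar> \<le> 1 / 2"
        using y d by (simp add: u_def abs_divide)
      have "ln (x - (z + h)) = ln (y * (1 + u))"
        using y d by (intro arg_cong[of _ _ ln]) (simp add: u_def y_def field_simps)
      also have "\<dots> = ln y + ln (1 + u)"
        using y d u by (intro ln_mult_pos) auto
      finally have "\<bar>ln (x - (z + h)) - ln y - u\<bar> \<le> 2 * u\<^sup>2"
        using abs_ln_one_plus_x_minus_x_bound[OF u] by simp
      also have "2 * u\<^sup>2 = 2 / y\<^sup>2 * h\<^sup>2"
        by (simp add: u_def power_divide)
      also have "\<dots> \<le> 2 / d\<^sup>2 * h\<^sup>2"
        using y d by (intro mult_right_mono divide_left_mono power_mono mult_pos_pos) auto
      finally show "norm (ln (x - (z + h)) - ln (x - z) - h * - (1 / (x - z))) \<le> (2 / d\<^sup>2) * (norm h)\<^sup>2"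
        by (simp add: u_def y_def)
    qed
  qed
  then show ?thesis by (simp add: stieltjes_def)
qed

text \<open>ln (x - z) - ln (- z) = ln (1 - x/z) is O(1/|z|) uniformly on the support. This
  normalization later fixes the constant when two functions are compared through their
  derivatives.\<close>

lemma ln_integral_asymp: "((\<lambda>z. (\<integral>x. ln (x - z) \<partial>M) - ln (- z)) \<longlongrightarrow> 0) at_bot"
proof (rule Lim_null_comparison)
  show "((\<lambda>z. 2 * (B / (- z))) \<longlongrightarrow> 0) at_bot" by real_asymp
  show "\<forall>\<^sub>F z in at_bot. norm ((\<integral>x. ln (x - z) \<partial>M) - ln (- z)) \<le> 2 * (B / (- z))"
    using eventually_gt_at_bot[of s] eventually_gt_at_bot[of 0] eventually_gt_at_bot[of "- (2 * B)"]
  proof eventually_elim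
    case (elim z)
    have int: "integrable M (\<lambda>x. ln (x - z))" using elim by (intro integrable_ln)
    have "(\<integral>x. ln (x - z) \<partial>M) - ln (- z) = (\<integral>x. ln (x - z) - ln (- z) \<partial>M)"
      using int by (simp add: prob_space)
    also have "norm \<dots> \<le> (\<integral>x. norm (ln (x - z) - ln (- z)) \<partial>M)"
      by (rule integral_norm_bound)
    also have "\<dots> \<le> 2 * (B / (- z))"
    proof (rule integral_le_const)
      show "integrable M (\<lambda>x. norm (ln (x - z) - ln (- z)))"
        using int by simp
      show "AE x in M. norm (ln (x - z) - ln (- z)) \<le> 2 * (B / (- z))"
        using upper
      proof eventually_elim
        case (elim x)
        have z: "- z > 0" "2 * B < - z" using \<open>z < 0\<close> \<open>z < - (2 * B)\<close> by auto
        define u where "u = x / z"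
        have "\<bar>u\<bar> = \<bar>x\<bar> / (- z)" using z by (simp add: u_def abs_divide)
        also have "\<dots> \<le> B / (- z)" using elim z by (intro divide_right_mono) auto
        finally have uB: "\<bar>u\<bar> \<le> B / (- z)" .
        also have "\<dots> \<le> 1 / 2" using z by (simp add: field_simps)
        finally have u: "\<bar>u\<bar> \<le> 1 / 2" .
        have "ln (x - z) = ln ((- z) * (1 - u))"
          using z by (intro arg_cong[of _ _ ln]) (simp add: u_def field_simps)
        also have "\<dots> = ln (- z) + ln (1 - u)"
          using z u by (intro ln_mult_pos) auto
        finally show ?case
          using ln_one_minus_bound[OF u] uB by simp
      qed
    qed
    finally show ?case .
  qed
qed

end

text \<open>The complement of the support is a union of open null sets, which Lindelof reduces to a
  countable one. The infimum of the nonempty compact support belongs to it, so each of its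
  neighbourhoods has mass.\<close>

lemma cs_prob_bounded_law:
  assumes "cs_prob \<rho>"
  obtains B where "bounded_law \<rho> (supp_minus \<rho>) B"
    and "\<And>\<epsilon>. \<epsilon> > 0 \<Longrightarrow> emeasure \<rho> {..<supp_minus \<rho> + \<epsilon>} > 0"
proof -
  interpret prob_space \<rho> using assms by (simp add: cs_prob_def)
  have sets [measurable_cong]: "sets \<rho> = sets borel" and comp: "compact (supp \<rho>)"
    using assms by (simp_all add: cs_prob_def)
  define \<F> where "\<F> = {U. open U \<and> emeasure \<rho> U = 0}"
  obtain \<F>' where \<F>': "\<F>' \<subseteq> \<F>" "countable \<F>'" "\<Union>\<F>' = \<Union>\<F>"
    using Lindelof[of \<F>] unfolding \<F>_def by blast
  have "supp \<rho> = - \<Union>\<F>"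
    by (auto simp: supp_def \<F>_def zero_less_iff_neq_zero)
  moreover have "AE x in \<rho>. x \<notin> \<Union>\<F>'"
  proof -
    have "AE x in \<rho>. \<forall>U\<in>\<F>'. x \<notin> U"
      using \<F>' by (subst AE_ball_countable) (auto simp: \<F>_def sets intro!: AE_not_in null_setsI)
    then show ?thesis by simp
  qed
  ultimately have AE: "AE x in \<rho>. x \<in> supp \<rho>"
    using \<F>' by simp
  have ne: "supp \<rho> \<noteq> {}"
  proof
    assume "supp \<rho> = {}"
    then show False using AE by simp
  qed
  obtain B where B: "\<And>x. x \<in> supp \<rho> \<Longrightarrow> \<bar>x\<bar> \<le> B"
    using compact_imp_bounded[OF comp] by (auto simp: bounded_iff)
  have bdd: "bdd_below (supp \<rho>)"
    using compact_imp_bounded[OF comp] by (rule bounded_imp_bdd_below)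
  have "bounded_law \<rho> (supp_minus \<rho>) B"
  proof unfold_locales
    show "AE x in \<rho>. supp_minus \<rho> \<le> x"
      using AE by eventually_elim (auto simp: supp_minus_def intro: cInf_lower bdd)
    show "AE x in \<rho>. \<bar>x\<bar> \<le> B"
      using AE by eventually_elim (rule B)
  qed (rule sets)
  moreover have "emeasure \<rho> {..<supp_minus \<rho> + \<epsilon>} > 0" if "\<epsilon> > 0" for \<epsilon>
  proof -
    have "supp_minus \<rho> \<in> supp \<rho>"
      unfolding supp_minus_def using ne comp by (intro closed_contains_Inf bdd compact_imp_closed)
    then show ?thesis using that by (auto simp: supp_def)
  qed
  ultimately show ?thesis using that by blast
qed

section \<open>Moments of the Marchenko--Pastur law\<close>

context bounded_law
begin

definition moment_fps :: "complex fps" where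
  "moment_fps = fps_X * Abs_fps (\<lambda>n. of_real (\<integral>x. x ^ n \<partial>M))"

definition moment_fun :: "complex \<Rightarrow> complex" where
  "moment_fun t = t * (\<integral>x. 1 / (1 - t * of_real x) \<partial>M)"

lemma moment_fun_has_fps_expansion: "moment_fun has_fps_expansion moment_fps"
  unfolding moment_fun_def moment_fps_def
proof (intro has_fps_expansion_mult has_fps_expansion_fps_X has_fps_expansionI)
  have "((\<lambda>t::complex. norm t * B) \<longlongrightarrow> norm (0::complex) * B) (nhds 0)"
    by (intro tendsto_intros filterlim_ident)
  then have "eventually (\<lambda>t::complex. norm t * B < 1) (nhds 0)"
    by (rule order_tendstoD) simp
  then show "\<forall>\<^sub>F t :: complex in nhds 0. (\<lambda>n. Abs_fps (\<lambda>n. of_real (\<integral>x. x ^ n \<partial>M)) $ n * t ^ n)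
      sums (\<integral>x. 1 / (1 - t * of_real x) \<partial>M)"
    by eventually_elim (simp add: moments_sums)
qed

lemma moment_fun_real:
  assumes "z < s" "z \<noteq> 0"
  shows "moment_fun (of_real (1 / z)) = - of_real (stieltjes M z)"
proof -
  have "(\<integral>x. 1 / (1 - of_real (1 / z) * of_real x :: complex) \<partial>M) = (\<integral>x. of_real (- z * (1 / (x - z))) \<partial>M)"
  proof (rule integral_cong_AE)
    show "AE x in M. 1 / (1 - of_real (1 / z) * of_real x :: complex) = of_real (- z * (1 / (x - z)))"
      using lower
    proof eventually_elim
      case (elim x)
      have "1 / (1 - (1 / z) * x) = - z * (1 / (x - z))"
        using assms elim by (simp add: divide_simps) (simp add: algebra_simps)
      then have "of_real (1 / (1 - (1 / z) * x)) = (of_real (- z * (1 / (x - z))) :: complex)"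
        by (simp only:)
      then show ?case by simp
    qed
  qed measurable
  also have "\<dots> = of_real (- z * stieltjes M z)"
    unfolding integral_complex_of_real integral_mult_right_zero stieltjes_def ..
  finally show ?thesis
    using assms by (simp add: moment_fun_def)
qed

end

section \<open>Integral of the root of a quadratic over a linear function\<close>

lemma arcsin_linear_deriv:
  fixes a b :: real
  assumes x: "a < x" "x < b"
  shows "((\<lambda>x. arcsin ((2 * x - a - b) / (b - a))) has_real_derivative 1 / sqrt ((b - x) * (x - a))) (at x)"
proof -
  define l where "l = (2 * x - a - b) / (b - a)"
  have ab: "b - a > 0" using x by simp
  have l: "-1 < l" "l < 1"
    using x ab by (simp_all add: l_def field_simps)
  have "1 - l\<^sup>2 = ((2 / (b - a)) * sqrt ((b - x) * (x - a)))\<^sup>2"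
    using x ab by (simp add: l_def power_mult_distrib power_divide divide_simps) (simp add: power2_eq_square algebra_simps)
  then have "sqrt (1 - l\<^sup>2) = (2 / (b - a)) * sqrt ((b - x) * (x - a))"
    using x ab by simp
  then have eq: "2 / (b - a) * inverse (sqrt (1 - l\<^sup>2)) = 1 / sqrt ((b - x) * (x - a))"
    using x ab by (simp add: field_simps)
  have "((\<lambda>x. 2 * x - a - b) has_real_derivative 2) (at x)"
    by (auto intro!: derivative_eq_intros)
  then have "((\<lambda>x. (2 * x - a - b) / (b - a)) has_real_derivative 2 / (b - a)) (at x)"
    by (rule DERIV_cdivide)
  from DERIV_chain2[OF DERIV_arcsin this] l eq show ?thesis
    by (simp add: l_def mult.commute)
qed

text \<open>\<open>k\<close> is the Moebius map that sends a to -1, b to 1 and z to infinity, the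
  counterpart of the affine map in the presence of the factor 1/(x - z).\<close>

lemma arcsin_moebius_deriv:
  fixes a b z :: real
  assumes x: "a < x" "x < b" and z: "z < a"
  defines "k \<equiv> \<lambda>x. ((a + b - 2 * z) * (x - z) - 2 * ((a - z) * (b - z))) / ((x - z) * (b - a))"
  shows "((\<lambda>x. arcsin (k x)) has_real_derivative
      sqrt ((a - z) * (b - z)) / ((x - z) * sqrt ((b - x) * (x - a)))) (at x)"
proof -
  let ?S = "(a - z) * (b - z)" and ?Q = "(b - x) * (x - a)"
  have pos: "b - a > 0" "x - z > 0" "?S > 0" "?Q > 0" using x z by auto
  have k1: "1 - k x = 2 * (a - z) * (b - x) / ((x - z) * (b - a))"
    and k2: "1 + k x = 2 * (b - z) * (x - a) / ((x - z) * (b - a))"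
    using pos by (simp_all add: k_def divide_simps) (simp_all add: algebra_simps)
  have "1 - k x > 0" "1 + k x > 0"
    unfolding k1 k2 using x z pos by auto
  then have k: "-1 < k x" "k x < 1" by auto
  have "1 - (k x)\<^sup>2 = (1 - k x) * (1 + k x)"
    by (simp add: power2_eq_square algebra_simps)
  also have "\<dots> = (2 * (a - z) * (b - x)) * (2 * (b - z) * (x - a)) / ((x - z) * (b - a))\<^sup>2"
    unfolding k1 k2 by (simp add: power2_eq_square)
  also have "\<dots> = 2\<^sup>2 * ?S * ?Q / ((x - z) * (b - a))\<^sup>2"
    by (rule arg_cong[of _ _ "\<lambda>y. y / _"]) algebra
  finally have "sqrt (1 - (k x)\<^sup>2) = 2 * sqrt ?S * sqrt ?Q / ((x - z) * (b - a))"
    using pos by (simp add: real_sqrt_mult real_sqrt_divide)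
  \<comment> \<open>Used with p = \<open>sqrt ?S\<close>, q = \<open>sqrt ?Q\<close>, y = x - z and
    c = b - a.\<close>
  moreover have "2 * (p * p) / (y\<^sup>2 * c) * inverse (2 * p * q / (y * c)) = p / (y * q)"
    if "p > 0" "q > 0" "y > 0" "c > 0" for p q y c :: real
    using that by (simp add: field_simps power2_eq_square)
  moreover have "sqrt ?S * sqrt ?S = ?S" "sqrt ?S > 0" "sqrt ?Q > 0" using pos by auto
  ultimately have eq: "2 * ?S / ((x - z)\<^sup>2 * (b - a)) * inverse (sqrt (1 - (k x)\<^sup>2)) = sqrt ?S / ((x - z) * sqrt ?Q)"
    using pos by metis
  have "(k has_real_derivative 2 * ?S / ((x - z)\<^sup>2 * (b - a))) (at x)"
    unfolding k_def using pos
    by (auto intro!: derivative_eq_intros simp: divide_simps) (simp add: power2_eq_square algebra_simps)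
  from DERIV_chain2[OF DERIV_arcsin this] k eq show ?thesis
    by (simp add: mult.commute)
qed

text \<open>\<open>F\<close> below is an antiderivative on the open interval. It comes from Q^2 = (a
  + b - x - z)(x - z) - S, which splits Q/(x - z) into the derivative of Q and two arcsine
  kernels.\<close>

lemma sqrt_quadratic_over_linear_has_integral:
  fixes a b z :: real
  assumes ab: "a < b" and z: "z \<le> a"
  shows "((\<lambda>x. sqrt ((b - x) * (x - a)) / (x - z)) has_integral
     pi * ((a + b) / 2 - z - sqrt ((a - z) * (b - z)))) {a..b}"
proof -
  define S where "S = (a - z) * (b - z)"
  define Q where "Q = (\<lambda>x. sqrt ((b - x) * (x - a)))"
  define l where "l = (\<lambda>x. (2 * x - a - b) / (b - a))"
  define k where "k = (\<lambda>x. ((a + b - 2 * z) * (x - z) - 2 * S) / ((x - z) * (b - a)))"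
  \<comment> \<open>At z = a the factor \<open>sqrt S\<close> is 0 while \<open>k\<close> has its
    pole at the end point; the case split keeps \<open>F\<close> continuous there. This case occurs
    for \<beta> = 1 and z = 0.\<close>
  define T where "T = (\<lambda>x. if z = a then 0 else sqrt S * arcsin (k x))"
  define F where "F = (\<lambda>x. Q x + ((a + b) / 2 - z) * arcsin (l x) - T x)"
  have S0: "S \<ge> 0" using ab z by (simp add: S_def)
  have lb: "-1 \<le> l x" "l x \<le> 1" if "x \<in> {a..b}" for x
    using that ab by (auto simp: l_def field_simps)
  have contT: "continuous_on {a..b} T"
  proof (cases "z = a")
    case False
    with z have za: "z < a" by simp
    have "-1 \<le> k x \<and> k x \<le> 1" if x: "x \<in> {a..b}" for x
    proof -
      have pos: "b - a > 0" "x - z > 0" using x ab za by auto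
      have "1 - k x = 2 * (a - z) * (b - x) / ((x - z) * (b - a))"
        "1 + k x = 2 * (b - z) * (x - a) / ((x - z) * (b - a))"
        using pos by (simp_all add: k_def S_def divide_simps) (simp_all add: algebra_simps)
      moreover have "2 * (a - z) * (b - x) / ((x - z) * (b - a)) \<ge> 0" "2 * (b - z) * (x - a) / ((x - z) * (b - a)) \<ge> 0"
        using x pos za by auto
      ultimately show ?thesis by auto
    qed
    moreover have "continuous_on {a..b} k"
      unfolding k_def using za ab by (auto intro!: continuous_intros)
    ultimately show ?thesis
      using False unfolding T_def by (auto intro!: continuous_intros)
  qed (simp add: T_def)
  have cont: "continuous_on {a..b} F"
    unfolding F_def
  proof (intro continuous_intros contT)
    show "continuous_on {a..b} Q" unfolding Q_def by (intro continuous_intros)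
    show "continuous_on {a..b} l" unfolding l_def using ab by (auto intro!: continuous_intros)
  qed (use lb in auto)
  have deriv: "(F has_real_derivative Q x / (x - z)) (at x)" if x: "x \<in> {a<..<b}" for x
  proof -
    have p: "(b - x) * (x - a) > 0" and xz: "x - z > 0"
      using x z by auto
    then have Qx: "Q x > 0" "(Q x)\<^sup>2 = (b - x) * (x - a)"
      unfolding Q_def by (blast intro: real_sqrt_gt_zero real_sqrt_pow2 less_imp_le)+
    have dQ: "(Q has_real_derivative ((a + b) / 2 - x) / Q x) (at x)"
    proof -
      have "((\<lambda>x. (b - x) * (x - a)) has_real_derivative a + b - 2 * x) (at x)"
        by (auto intro!: derivative_eq_intros simp: algebra_simps)
      from DERIV_chain2[OF DERIV_real_sqrt[OF p] this] show ?thesis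
        by (simp add: Q_def field_simps)
    qed
    have dl: "((\<lambda>x. arcsin (l x)) has_real_derivative 1 / Q x) (at x)"
      unfolding l_def Q_def by (rule arcsin_linear_deriv) (use x in auto)
    have dT: "(T has_real_derivative S / ((x - z) * Q x)) (at x)"
    proof (cases "z = a")
      case True
      then show ?thesis by (simp add: T_def S_def)
    next
      case False
      have "((\<lambda>x. arcsin (k x)) has_real_derivative sqrt S / ((x - z) * Q x)) (at x)"
        unfolding k_def Q_def S_def by (rule arcsin_moebius_deriv) (use x z False in auto)
      then have "((\<lambda>x. sqrt S * arcsin (k x)) has_real_derivative sqrt S * (sqrt S / ((x - z) * Q x))) (at x)"
        by (rule DERIV_cmult)
      then show ?thesis using False S0 by (simp add: T_def)
    qed
    have "((a + b) / 2 - x) / Q x + ((a + b) / 2 - z) * (1 / Q x) - S / ((x - z) * Q x)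
        = ((a + b - x - z) * (x - z) - S) / ((x - z) * Q x)"
      using Qx xz by (simp add: field_simps)
    also have "(a + b - x - z) * (x - z) - S = Q x * Q x"
      using Qx(2) by (simp add: S_def power2_eq_square algebra_simps)
    also have "Q x * Q x / ((x - z) * Q x) = Q x / (x - z)"
      using Qx by simp
    finally show ?thesis
      unfolding F_def using DERIV_diff[OF DERIV_add[OF dQ DERIV_cmult[OF dl, of "(a + b) / 2 - z"]] dT] by simp
  qed
  have "((\<lambda>x. Q x / (x - z)) has_integral F b - F a) {a..b}"
    by (rule fundamental_theorem_of_calculus_interior)
       (use ab cont deriv in \<open>auto simp flip: has_real_derivative_iff_has_vector_derivative\<close>)
  moreover have "F b - F a = pi * ((a + b) / 2 - z - sqrt S)"
  proof -
    have "Q a = 0" "Q b = 0" by (simp_all add: Q_def)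
    moreover have "l a = -1" "l b = 1" using ab by (simp_all add: l_def field_simps)
    moreover have "T b - T a = sqrt S * pi"
    proof (cases "z = a")
      case False
      with z have za: "z < a" by simp
      have "k a = -1" "k b = 1"
        using za ab by (simp_all add: k_def S_def divide_simps) (simp_all add: algebra_simps)
      then show ?thesis using False by (simp add: T_def algebra_simps)
    qed (simp add: T_def S_def)
    ultimately show ?thesis by (simp add: F_def field_simps)
  qed
  ultimately show ?thesis by (simp add: Q_def S_def)
qed

section \<open>Integration against the Marchenko-Pastur law\<close>

lemma measurable_mp_density [measurable]: "mp_density \<beta> \<in> borel_measurable borel"
  unfolding mp_density_def by measurable

lemma nn_integral_marchenko_pastur:
  assumes "f \<in> borel_measurable borel"
  shows "(\<integral>\<^sup>+x. f x \<partial>marchenko_pastur \<beta>) =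
    ennreal (max (1 - \<beta>) 0) * f 0 + (\<integral>\<^sup>+x. ennreal (mp_density \<beta> x) * f x \<partial>lborel)"
  using assms
proof (induction rule: borel_measurable_induct)
  case (cong f g)
  then show ?case by (simp cong: nn_integral_cong)
next
  case (set A)
  then have "(\<integral>\<^sup>+x. indicator A x \<partial>marchenko_pastur \<beta>) = emeasure (marchenko_pastur \<beta>) A"
    by (intro nn_integral_indicator) simp
  then show ?case
    using set by (simp add: emeasure_marchenko_pastur)
next
  case (mult u c)
  then have [measurable]: "u \<in> borel_measurable borel" "u \<in> borel_measurable (marchenko_pastur \<beta>)"
    by (simp_all cong: measurable_cong_sets)
  have "(\<integral>\<^sup>+x. ennreal (mp_density \<beta> x) * (c * u x) \<partial>lborel) = (\<integral>\<^sup>+x. c * (ennreal (mp_density \<beta> x) * u x) \<partial>lborel)"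
    by (simp add: mult_ac)
  then show ?case
    using mult by (simp add: nn_integral_cmult distrib_left mult_ac)
next
  case (add u v)
  then have [measurable]: "u \<in> borel_measurable borel" "u \<in> borel_measurable (marchenko_pastur \<beta>)"
      "v \<in> borel_measurable borel" "v \<in> borel_measurable (marchenko_pastur \<beta>)"
    by (simp_all cong: measurable_cong_sets)
  show ?case
    using add by (simp add: nn_integral_add distrib_left add_ac)
next
  case (seq U)
  have [measurable]: "U i \<in> borel_measurable borel" "U i \<in> borel_measurable (marchenko_pastur \<beta>)" for i
    using seq(1)[of i] by (simp_all cong: measurable_cong_sets)
  have inc: "incseq (\<lambda>i x. ennreal (mp_density \<beta> x) * U i x)"
    using \<open>incseq U\<close> by (auto simp: incseq_def le_fun_def intro!: mult_left_mono)
  have inc': "incseq (\<lambda>i. ennreal (max (1 - \<beta>) 0) * U i 0)"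
    using \<open>incseq U\<close> by (auto simp: incseq_def le_fun_def intro!: mult_left_mono)
  have inc'': "incseq (\<lambda>i. \<integral>\<^sup>+x. ennreal (mp_density \<beta> x) * U i x \<partial>lborel)"
    using inc by (auto simp: incseq_def le_fun_def intro!: nn_integral_mono)
  have "(\<integral>\<^sup>+x. (SUP i. U i) x \<partial>marchenko_pastur \<beta>) = (SUP i. \<integral>\<^sup>+x. U i x \<partial>marchenko_pastur \<beta>)"
    unfolding SUP_apply by (rule nn_integral_monotone_convergence_SUP) (use \<open>incseq U\<close> in auto)
  also have "\<dots> = (SUP i. ennreal (max (1 - \<beta>) 0) * U i 0) + (SUP i. \<integral>\<^sup>+x. ennreal (mp_density \<beta> x) * U i x \<partial>lborel)"
    unfolding seq.IH using inc' inc'' by (rule ennreal_SUP_add)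
  also have "(SUP i. \<integral>\<^sup>+x. ennreal (mp_density \<beta> x) * U i x \<partial>lborel)
      = (\<integral>\<^sup>+x. (SUP i. ennreal (mp_density \<beta> x) * U i x) \<partial>lborel)"
    by (rule nn_integral_monotone_convergence_SUP[symmetric, OF inc]) measurable
  finally show ?case
    by (simp add: SUP_mult_left_ennreal SUP_apply image_comp)
qed

context
  fixes \<beta> :: real
  assumes \<beta>: "\<beta> > 0"
begin

lemma mp_minus_less_plus: "mp_minus \<beta> < mp_plus \<beta>"
  using \<beta> by (simp add: mp_minus_def mp_plus_def power2_eq_square algebra_simps)

lemma mp_minus_nonneg: "0 \<le> mp_minus \<beta>"
  by (simp add: mp_minus_def)

lemma mp_sum: "mp_minus \<beta> + mp_plus \<beta> = 2 * (1 + \<beta>)"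
  using \<beta> by (simp add: mp_minus_def mp_plus_def power2_eq_square algebra_simps)

lemma mp_prod: "mp_minus \<beta> * mp_plus \<beta> = (1 - \<beta>)\<^sup>2"
proof -
  have "mp_minus \<beta> * mp_plus \<beta> = ((1 - sqrt \<beta>) * (1 + sqrt \<beta>))\<^sup>2"
    by (simp add: mp_minus_def mp_plus_def power_mult_distrib)
  also have "(1 - sqrt \<beta>) * (1 + sqrt \<beta>) = 1 - \<beta>"
    using \<beta> by (simp add: algebra_simps)
  finally show ?thesis .
qed

lemma mp_density_nonneg: "0 \<le> mp_density \<beta> x"
  using mp_minus_nonneg by (auto simp: mp_density_def indicator_def intro!: divide_nonneg_nonneg mult_nonneg_nonneg)

lemma mp_density_stieltjes_nonneg:
  assumes "z < 0"
  shows "0 \<le> mp_density \<beta> x * (1 / (x - z))"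
proof (cases "x \<ge> 0")
  case True
  then show ?thesis
    using assms mp_density_nonneg[of x] by (intro mult_nonneg_nonneg) auto
next
  case False
  then show ?thesis
    using mp_minus_nonneg by (simp add: mp_density_def)
qed

lemma sqrt_quadratic_over_linear_mp:
  "z \<le> 0 \<Longrightarrow> ((\<lambda>x. sqrt ((mp_plus \<beta> - x) * (x - mp_minus \<beta>)) / (x - z)) has_integral
     pi * (1 + \<beta> - z - sqrt ((mp_minus \<beta> - z) * (mp_plus \<beta> - z)))) {mp_minus \<beta>..mp_plus \<beta>}"
  using sqrt_quadratic_over_linear_has_integral[OF mp_minus_less_plus, of z] mp_minus_nonneg
  by (simp add: mp_sum add_divide_distrib)

text \<open>The value is min 1 \<beta>, the mass that the atom at 0 leaves to the density; |1 -
  \<beta>| is the square root of the product of the end points.\<close>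

lemma mp_density_has_integral: "(mp_density \<beta> has_integral (1 + \<beta> - \<bar>1 - \<beta>\<bar>) / 2) UNIV"
proof -
  let ?q = "\<lambda>x. sqrt ((mp_plus \<beta> - x) * (x - mp_minus \<beta>))"
  have "((\<lambda>x. ?q x / (x - 0) * (1 / (2 * pi))) has_integral (pi * (1 + \<beta> - \<bar>1 - \<beta>\<bar>)) * (1 / (2 * pi))) {mp_minus \<beta>..mp_plus \<beta>}"
    using sqrt_quadratic_over_linear_mp[of 0] by (intro has_integral_mult_left) (simp add: mp_prod)
  then have "((\<lambda>x. ?q x / (2 * pi * x)) has_integral (1 + \<beta> - \<bar>1 - \<beta>\<bar>) / 2) {mp_minus \<beta>..mp_plus \<beta>}"
    by (simp add: mult_ac)
  then have "((\<lambda>x. if x \<in> {mp_minus \<beta>..mp_plus \<beta>} then ?q x / (2 * pi * x) else 0) has_integral (1 + \<beta> - \<bar>1 - \<beta>\<bar>) / 2) UNIV"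
    by (simp only: has_integral_restrict_UNIV)
  moreover have "(\<lambda>x. if x \<in> {mp_minus \<beta>..mp_plus \<beta>} then ?q x / (2 * pi * x) else 0) = mp_density \<beta>"
    by (auto simp: fun_eq_iff mp_density_def)
  ultimately show ?thesis by simp
qed

text \<open>Partial fractions, 1/(x (x - z)) = (1/(x - z) - 1/x) / z, reduce this to the root
  integral at z and at 0.\<close>

lemma mp_density_stieltjes_has_integral:
  assumes "z < 0"
  shows "((\<lambda>x. mp_density \<beta> x * (1 / (x - z))) has_integral
     (\<bar>1 - \<beta>\<bar> - z - sqrt ((mp_minus \<beta> - z) * (mp_plus \<beta> - z))) / (2 * z)) UNIV"
proof -
  let ?q = "\<lambda>x. sqrt ((mp_plus \<beta> - x) * (x - mp_minus \<beta>))"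
  let ?R = "sqrt ((mp_minus \<beta> - z) * (mp_plus \<beta> - z))"
  have "((\<lambda>x. (?q x / (x - z) - ?q x / (x - 0)) * (1 / (2 * pi * z))) has_integral
      (pi * (1 + \<beta> - z - ?R) - pi * (1 + \<beta> - \<bar>1 - \<beta>\<bar>)) * (1 / (2 * pi * z))) {mp_minus \<beta>..mp_plus \<beta>}"
    using sqrt_quadratic_over_linear_mp[of 0] sqrt_quadratic_over_linear_mp[of z] assms
    by (intro has_integral_mult_left has_integral_diff) (simp_all add: mp_prod)
  also have "(pi * (1 + \<beta> - z - ?R) - pi * (1 + \<beta> - \<bar>1 - \<beta>\<bar>)) * (1 / (2 * pi * z)) = (\<bar>1 - \<beta>\<bar> - z - ?R) / (2 * z)"
    using assms by (simp add: divide_simps) (simp add: algebra_simps)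
  finally have "((\<lambda>x. if x \<in> {mp_minus \<beta>..mp_plus \<beta>} then (?q x / (x - z) - ?q x / (x - 0)) * (1 / (2 * pi * z)) else 0)
      has_integral (\<bar>1 - \<beta>\<bar> - z - ?R) / (2 * z)) UNIV"
    by (simp only: has_integral_restrict_UNIV)
  moreover have "(if x \<in> {mp_minus \<beta>..mp_plus \<beta>} then (?q x / (x - z) - ?q x / (x - 0)) * (1 / (2 * pi * z)) else 0)
      = mp_density \<beta> x * (1 / (x - z))" for x
  proof (cases "x \<in> {mp_minus \<beta>..mp_plus \<beta>}")
    case True
    show ?thesis
    \<comment> \<open>The point 0 lies in the interval only if \<open>mp_minus \<beta> = 0\<close>;
      it is then the left end, where the square root vanishes.\<close>
    proof (cases "x = 0")
      case True
      with \<open>x \<in> _\<close> mp_minus_nonneg have "mp_minus \<beta> = 0" by simp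
      then show ?thesis using True by (simp add: mp_density_def)
    next
      case False
      then have "x > 0" "x - z > 0" using \<open>x \<in> _\<close> mp_minus_nonneg assms by auto
      then show ?thesis
        using assms \<open>x \<in> _\<close> by (simp add: mp_density_def divide_simps) (simp add: algebra_simps)
    qed
  qed (auto simp: mp_density_def)
  ultimately show ?thesis by (simp cong: if_cong)
qed

lemma marchenko_pastur_bounded_law: "bounded_law (marchenko_pastur \<beta>) 0 (mp_plus \<beta>)"
proof -
  have space: "space (marchenko_pastur \<beta>) = UNIV"
    using sets_eq_imp_space_eq[OF sets_marchenko_pastur[of \<beta>]] by simp
  have "emeasure (marchenko_pastur \<beta>) UNIV = ennreal (max (1 - \<beta>) 0) + (\<integral>\<^sup>+x. ennreal (mp_density \<beta> x) \<partial>lborel)"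
    by (simp add: emeasure_marchenko_pastur)
  also have "(\<integral>\<^sup>+x. ennreal (mp_density \<beta> x) \<partial>lborel) = ennreal ((1 + \<beta> - \<bar>1 - \<beta>\<bar>) / 2)"
    by (rule nn_integral_has_integral_lborel[OF measurable_mp_density mp_density_nonneg mp_density_has_integral])
  also have "ennreal (max (1 - \<beta>) 0) + \<dots> = 1"
    using \<beta> by (auto simp: max_def abs_if simp flip: ennreal_plus)
  finally interpret prob_space "marchenko_pastur \<beta>"
    by (intro prob_spaceI) (simp add: space)
  have "emeasure (marchenko_pastur \<beta>) (- {0..mp_plus \<beta>}) = 0"
  proof -
    have zero: "mp_density \<beta> x = 0" if "x \<in> - {0..mp_plus \<beta>}" for x
      using that mp_minus_nonneg by (auto simp: mp_density_def)
    have "(\<integral>\<^sup>+x\<in>- {0..mp_plus \<beta>}. ennreal (mp_density \<beta> x) \<partial>lborel) = (\<integral>\<^sup>+x. 0 \<partial>(lborel :: real measure))"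
    proof (intro nn_integral_cong)
      fix x
      show "ennreal (mp_density \<beta> x) * indicator (- {0..mp_plus \<beta>}) x = 0"
        by (cases "x \<in> - {0..mp_plus \<beta>}") (simp_all add: zero)
    qed
    moreover have "mp_plus \<beta> \<ge> 0" by (simp add: mp_plus_def)
    ultimately show ?thesis
      by (subst emeasure_marchenko_pastur) auto
  qed
  then have "AE x in marchenko_pastur \<beta>. x \<notin> - {0..mp_plus \<beta>}"
    by (intro AE_not_in null_setsI) auto
  then show ?thesis
    by unfold_locales auto
qed

lemma stieltjes_marchenko_pastur:
  assumes "z < 0"
  shows "stieltjes (marchenko_pastur \<beta>) z =
    (\<beta> - 1 - z - sqrt ((mp_minus \<beta> - z) * (mp_plus \<beta> - z))) / (2 * z)"
proof -
  interpret bounded_law "marchenko_pastur \<beta>" 0 "mp_plus \<beta>"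
    by (rule marchenko_pastur_bounded_law)
  let ?R = "sqrt ((mp_minus \<beta> - z) * (mp_plus \<beta> - z))"
  let ?I = "(\<bar>1 - \<beta>\<bar> - z - ?R) / (2 * z)"
  \<comment> \<open>Absolute values make the integrand nonnegative everywhere; it agrees with 1/(x -
    z) almost everywhere since the law lives on x \<ge> 0.\<close>
  let ?f = "\<lambda>x. \<bar>1 / (x - z)\<bar>"
  have nn: "(\<integral>\<^sup>+x. ennreal (mp_density \<beta> x) * ennreal (?f x) \<partial>lborel) = ennreal ?I"
  proof -
    have "(\<integral>\<^sup>+x. ennreal (mp_density \<beta> x) * ennreal (?f x) \<partial>lborel) = (\<integral>\<^sup>+x. ennreal (mp_density \<beta> x * (1 / (x - z))) \<partial>lborel)"
    proof (intro nn_integral_cong)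
      fix x
      show "ennreal (mp_density \<beta> x) * ennreal (?f x) = ennreal (mp_density \<beta> x * (1 / (x - z)))"
        using mp_density_nonneg[of x] mp_minus_nonneg assms
        by (cases "x \<ge> 0") (auto simp: mp_density_def simp flip: ennreal_mult)
    qed
    also have "\<dots> = ennreal ?I"
    proof (rule nn_integral_has_integral_lborel[OF _ _ mp_density_stieltjes_has_integral[OF assms]])
      show "0 \<le> mp_density \<beta> x * (1 / (x - z))" for x
        by (rule mp_density_stieltjes_nonneg[OF assms])
    qed measurable
    finally show ?thesis .
  qed
  have I0: "?I \<ge> 0"
    by (rule has_integral_nonneg[OF mp_density_stieltjes_has_integral[OF assms]])
       (rule mp_density_stieltjes_nonneg[OF assms])
  have "(\<integral>\<^sup>+x. ennreal (?f x) \<partial>marchenko_pastur \<beta>) = ennreal (max (1 - \<beta>) 0) * ennreal (?f 0) + ennreal ?I"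
    by (subst nn_integral_marchenko_pastur, measurable, simp only: nn)
  also have "\<dots> = ennreal (max (1 - \<beta>) 0 * (1 / (- z)) + ?I)"
  proof -
    have f0: "?f 0 = 1 / (- z)" using assms by simp
    show ?thesis
      unfolding f0 using assms I0
      by (subst ennreal_mult[symmetric]; (subst ennreal_plus[symmetric])?) (auto intro!: divide_nonneg_neg)
  qed
  finally have *: "(\<integral>\<^sup>+x. ennreal (?f x) \<partial>marchenko_pastur \<beta>) = ennreal (max (1 - \<beta>) 0 * (1 / (- z)) + ?I)" .
  have "stieltjes (marchenko_pastur \<beta>) z = (\<integral>x. ?f x \<partial>marchenko_pastur \<beta>)"
    unfolding stieltjes_def
  proof (rule integral_cong_AE)
    show "AE x in marchenko_pastur \<beta>. 1 / (x - z) = ?f x"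
      using lower by eventually_elim (use assms in auto)
  qed measurable
  also have "\<dots> = max (1 - \<beta>) 0 * (1 / (- z)) + ?I"
  proof -
    have "max (1 - \<beta>) 0 * (1 / (- z)) + ?I \<ge> 0"
      using assms I0 by (intro add_nonneg_nonneg mult_nonneg_nonneg) auto
    then have "enn2real (\<integral>\<^sup>+x. ennreal (?f x) \<partial>marchenko_pastur \<beta>) = max (1 - \<beta>) 0 * (1 / (- z)) + ?I"
      unfolding * by (rule enn2real_ennreal)
    moreover have "(\<integral>x. ?f x \<partial>marchenko_pastur \<beta>) = enn2real (\<integral>\<^sup>+x. ennreal (?f x) \<partial>marchenko_pastur \<beta>)"
      by (rule integral_eq_nn_integral) auto
    ultimately show ?thesis by simp
  qed
  \<comment> \<open>The atom turns |1 - \<beta>| into \<beta> - 1, so one formula covers \<beta> < 1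
    and \<beta> \<ge> 1.\<close>
  also have "\<dots> = (\<beta> - 1 - z - ?R) / (2 * z)"
    using assms by (auto simp: max_def abs_if divide_simps)
  finally show ?thesis .
qed

lemma stieltjes_marchenko_pastur_quadratic:
  assumes "z < 0"
  defines "g \<equiv> stieltjes (marchenko_pastur \<beta>) z"
  shows "z * g\<^sup>2 + (z - \<beta> + 1) * g + 1 = 0"
proof -
  let ?R = "sqrt ((mp_minus \<beta> - z) * (mp_plus \<beta> - z))"
  have "2 * z * g + (z - \<beta> + 1) = - ?R"
    using assms by (simp add: g_def stieltjes_marchenko_pastur)
  then have "(2 * z * g + (z - \<beta> + 1))\<^sup>2 = (mp_minus \<beta> - z) * (mp_plus \<beta> - z)"
    using assms(1) mp_minus_nonneg mp_minus_less_plus by simp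
  also have "\<dots> = mp_minus \<beta> * mp_plus \<beta> - z * (mp_minus \<beta> + mp_plus \<beta>) + z\<^sup>2"
    by (simp add: power2_eq_square algebra_simps)
  also have "\<dots> = (z - \<beta> + 1)\<^sup>2 - 4 * z"
    by (simp add: mp_sum mp_prod power2_eq_square algebra_simps)
  finally have "4 * z * (z * g\<^sup>2 + (z - \<beta> + 1) * g + 1) = 0"
    by (simp add: power2_eq_square algebra_simps)
  then show ?thesis using assms(1) by simp
qed

text \<open>The quadratic equation holds at t = 1/z for all z < 0. These points accumulate at 0, so
  the expansion of the difference of its two sides vanishes.\<close>

lemma marchenko_pastur_moment_fps:
  defines "P \<equiv> bounded_law.moment_fps (marchenko_pastur \<beta>)"
  shows "P - P\<^sup>2 = fps_X * (1 + fps_const (of_real \<beta> - 1) * P)"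
proof -
  interpret bounded_law "marchenko_pastur \<beta>" 0 "mp_plus \<beta>"
    by (rule marchenko_pastur_bounded_law)
  let ?h = "\<lambda>t. moment_fun t - (moment_fun t)\<^sup>2 - t * (1 + (of_real \<beta> - 1) * moment_fun t)"
  let ?H = "P - P\<^sup>2 - fps_X * (1 + fps_const (of_real \<beta> - 1) * P)"
  have "?h has_fps_expansion ?H"
    unfolding P_def by (intro fps_expansion_intros moment_fun_has_fps_expansion)
  then have L: "?h has_laurent_expansion fps_to_fls ?H"
    by (rule has_laurent_expansion_fps)
  have zero: "?h (of_real (1 / z)) = 0" if "z < 0" for z
  proof -
    let ?g = "stieltjes (marchenko_pastur \<beta>) z"
    have "z * ((- ?g) - (- ?g)\<^sup>2 - (1 / z) * (1 + (\<beta> - 1) * (- ?g))) = 0"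
      using stieltjes_marchenko_pastur_quadratic[OF that] that by (simp add: algebra_simps)
    then have "(- ?g) - (- ?g)\<^sup>2 - (1 / z) * (1 + (\<beta> - 1) * (- ?g)) = 0"
      using that by simp
    then have "complex_of_real ((- ?g) - (- ?g)\<^sup>2 - (1 / z) * (1 + (\<beta> - 1) * (- ?g))) = 0"
      by (simp only: of_real_0)
    then have "- of_real ?g - (- of_real ?g)\<^sup>2 - of_real (1 / z) * (1 + (of_real \<beta> - 1) * (- of_real ?g)) = (0 :: complex)"
      by (simp only: of_real_diff of_real_mult of_real_power of_real_add of_real_1 of_real_minus)
    moreover have "moment_fun (of_real (1 / z)) = - of_real ?g"
      using that by (intro moment_fun_real) auto
    ultimately show ?thesis
      by (simp only:)
  qed
  have lim: "filterlim (\<lambda>z. complex_of_real (1 / z)) (at 0) at_bot"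
  proof (rule filterlim_atI)
    have "((\<lambda>z::real. 1 / z) \<longlongrightarrow> 0) at_bot" by real_asymp
    then have "((\<lambda>z. complex_of_real (1 / z)) \<longlongrightarrow> of_real 0) at_bot" by (rule tendsto_of_real)
    then show "((\<lambda>z. complex_of_real (1 / z)) \<longlongrightarrow> 0) at_bot" by simp
    show "\<forall>\<^sub>F z in at_bot. complex_of_real (1 / z) \<noteq> 0"
      using eventually_gt_at_bot[of 0] by eventually_elim auto
  qed
  have "\<exists>\<^sub>F t in at 0. ?h t = 0"
  proof (rule ccontr)
    assume "\<not> (\<exists>\<^sub>F t in at 0. ?h t = 0)"
    then have "\<forall>\<^sub>F t in at 0. ?h t \<noteq> 0" by (simp add: not_frequently)
    then have "\<forall>\<^sub>F z in at_bot. ?h (complex_of_real (1 / z)) \<noteq> 0"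
      using lim by (rule eventually_compose_filterlim)
    then have "\<forall>\<^sub>F z :: real in at_bot. False"
      using eventually_gt_at_bot[of 0] by eventually_elim (use zero in auto)
    then show False by simp
  qed
  then have "fps_to_fls ?H = 0"
    using has_laurent_expansion_frequently_zero_iff[of ?h 0 "fps_to_fls ?H"] L by simp
  then have "?H = 0" by (simp only: fps_to_fls_eq_0_iff)
  then show ?thesis by (simp only: eq_iff_diff_eq_0[symmetric])
qed

end

section \<open>The subordination equation\<close>

context bounded_law
begin

text \<open>Pringsheim's theorem: the Taylor coefficients of the Stieltjes transform are positive, so it
  is singular at the end point of the support.\<close>

lemma no_holomorphic_extension:
  assumes mass: "\<And>\<epsilon>. \<epsilon> > 0 \<Longrightarrow> emeasure M {..<s + \<epsilon>} > 0"
    and "e > 0" and F: "F holomorphic_on ball (of_real s) e"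
    and eq: "\<And>w. s - e < w \<Longrightarrow> w < s \<Longrightarrow> F (of_real w) = of_real (stieltjes M w)"
  shows False
proof -
  \<comment> \<open>About this point the series of \<open>F\<close> converges on radius 3e/4, hence
    e/2 beyond \<open>s\<close>, while that of \<open>G\<close> is so far known only on radius
    e/4.\<close>
  define w where "w = s - e / 4"
  define m where "m = (\<lambda>n. \<integral>x. 1 / (x - w) ^ Suc n \<partial>M)"
  define c where "c = (\<lambda>n. (deriv ^^ n) F (of_real w) / fact n)"
  have w: "w < s" using \<open>e > 0\<close> by (simp add: w_def)
  have sub: "ball (complex_of_real w) (3 * e / 4) \<subseteq> ball (of_real s) e"
  proof (rule ball_subset_ball_iff[THEN iffD2], rule disjI1)
    show "dist (complex_of_real w) (of_real s) + 3 * e / 4 \<le> e"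
      using \<open>e > 0\<close> by (simp add: dist_of_real w_def dist_real_def)
  qed
  have c: "(\<lambda>n. c n * u ^ n) sums F (of_real w + u)" if "norm u < 3 * e / 4" for u
    using holomorphic_power_series[OF holomorphic_on_subset[OF F sub], of "of_real w + u"] that
    by (simp add: c_def dist_norm)
  have m: "(\<lambda>n. of_real (m n) * u ^ n) sums G (of_real w + u)" if "norm u < e / 4" for u :: complex
    using G_sums[OF w, of "of_real w + u"] that by (simp add: m_def w_def)
  have FG: "F (of_real w + of_real u) = G (of_real w + of_real u)" if "\<bar>u\<bar> < e / 4" for u
    using eq[of "w + u"] G_of_real[of "w + u"] that by (simp add: w_def)
  \<comment> \<open>The two functions agree on a real interval around \<open>w\<close>, whereas
    zeros of a nonzero power series are isolated.\<close>
  have cm: "c n = of_real (m n)" for n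
  proof (rule ccontr)
    assume n: "c n \<noteq> of_real (m n)"
    let ?f = "\<lambda>u. F (of_real w + u) - G (of_real w + u)"
    have sums: "(\<lambda>n. (c n - of_real (m n)) * u ^ n) sums ?f u" if "norm u < e / 4" for u
      using sums_diff[OF c m] that \<open>e > 0\<close> by (simp add: left_diff_distrib)
    have f0: "?f 0 = 0"
      using FG[of 0] \<open>e > 0\<close> by simp
    have "(\<lambda>n. (c n - of_real (m n)) * 0 ^ n) sums (c 0 - of_real (m 0))"
      by (rule powser_sums_zero)
    with sums[of 0] f0 \<open>e > 0\<close> have "c 0 = of_real (m 0)"
      by (simp add: sums_unique2)
    with n have "n > 0" by (cases n) auto
    obtain r where r: "r > 0" "\<And>u. u \<in> cball 0 r - {0} \<Longrightarrow> ?f u \<noteq> 0"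
      by (rule powser_0_nonzero[of "e / 4" 0 "\<lambda>n. c n - of_real (m n)" ?f n])
         (use sums f0 n \<open>n > 0\<close> \<open>e > 0\<close> in auto)
    define u where "u = min r (e / 8)"
    have "u > 0" "u \<le> r" "u < e / 4" using r \<open>e > 0\<close> by (auto simp: u_def)
    then show False
      using r(2)[of "of_real u"] FG[of u] by simp
  qed
  \<comment> \<open>The point w + e/2 = s + e/4 lies beyond \<open>s\<close>; convergence there
    forces the terms to 0.\<close>
  have "summable (\<lambda>n. c n * of_real (e / 2) ^ n)"
    using c[of "of_real (e / 2)"] \<open>e > 0\<close> unfolding norm_of_real by (simp add: sums_iff)
  then have "(\<lambda>n. c n * of_real (e / 2) ^ n) \<longlonglongrightarrow> 0"
    by (rule summable_LIMSEQ_zero)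
  then have lim: "(\<lambda>n. norm (c n * of_real (e / 2) ^ n)) \<longlonglongrightarrow> 0"
    by (rule tendsto_norm_zero)
  \<comment> \<open>On the part of the support below s + e/8 one has x - w \<le> 3e/8 < e/2, so this
    mass alone keeps the n-th term above p / (3e/8).\<close>
  define p where "p = measure M {..<s + e / 8}"
  have p: "p > 0"
    using mass[of "e / 8"] \<open>e > 0\<close> by (simp add: p_def emeasure_eq_measure)
  have "p / (3 * e / 8) \<le> norm (c n * of_real (e / 2) ^ n)" for n
  proof -
    have "p / (3 * e / 8) ^ Suc n = (\<integral>x. indicator {..<s + e / 8} x / (3 * e / 8) ^ Suc n \<partial>M)"
      by (simp add: p_def)
    also have "\<dots> \<le> m n"
      unfolding m_def
    proof (rule integral_mono_AE)
      show "integrable M (\<lambda>x. indicator {..<s + e / 8} x / (3 * e / 8) ^ Suc n)"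
        by (intro integrable_divide_zero integrable_real_indicator) (auto simp: emeasure_eq_measure)
      show "integrable M (\<lambda>x. 1 / (x - w) ^ Suc n)"
        by (rule integrable_real_inverse_power[OF w])
      show "AE x in M. indicator {..<s + e / 8} x / (3 * e / 8) ^ Suc n \<le> 1 / (x - w) ^ Suc n"
        using lower
      proof eventually_elim
        case (elim x)
        then have "x - w > 0" using w by simp
        moreover have "x - w \<le> 3 * e / 8" if "x < s + e / 8"
          using that by (simp add: w_def)
        ultimately show ?case
          by (auto simp: indicator_def simp del: power_Suc intro!: divide_left_mono power_mono)
      qed
    qed
    finally have mn: "p / (3 * e / 8) ^ Suc n \<le> m n" .
    have "p / (3 * e / 8) = p / (3 * e / 8) ^ Suc n * (3 * e / 8) ^ n"
      using \<open>e > 0\<close> by simp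
    also have "\<dots> \<le> p / (3 * e / 8) ^ Suc n * (e / 2) ^ n"
      using \<open>e > 0\<close> p by (intro mult_left_mono power_mono) auto
    also have "\<dots> \<le> m n * (e / 2) ^ n"
      using \<open>e > 0\<close> by (intro mult_right_mono mn) auto
    also have "\<dots> \<le> \<bar>m n\<bar> * \<bar>e / 2\<bar> ^ n"
      using \<open>e > 0\<close> by (intro mult_mono) auto
    also have "\<dots> = norm (c n * of_real (e / 2) ^ n)"
      unfolding cm norm_mult norm_power norm_of_real ..
    finally show ?thesis .
  qed
  then have "p / (3 * e / 8) \<le> 0"
    by (intro LIMSEQ_le_const[OF lim]) auto
  then show False
    using p \<open>e > 0\<close> by (simp add: field_simps)
qed

end

text \<open>\<open>R\<close> is the law of the sum and \<open>N\<close> the law \<nu>. Freeness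
  enters only through \<open>near_infinity\<close>; together with the lower bound,
  \<open>mass\<close> says that \<open>n\<close> is the true left end of the support of
  \<open>N\<close>.\<close>

locale subordination = R: bounded_law R r A + N: bounded_law N n B
  for R N :: "real measure" and r A n B :: real +
  fixes \<beta> :: real
  assumes \<beta>: "\<beta> > 0"
    and near_infinity: "\<forall>\<^sub>F z in at_bot. stieltjes N (z - \<beta> / (1 + stieltjes R z)) = stieltjes R z"
    and mass: "\<And>\<epsilon>. \<epsilon> > 0 \<Longrightarrow> emeasure N {..<n + \<epsilon>} > 0"
begin

definition \<omega> :: "real \<Rightarrow> real" where
  "\<omega> z = z - \<beta> / (1 + stieltjes R z)"

definition \<Omega> :: "complex \<Rightarrow> complex" where
  "\<Omega> z = z - of_real \<beta> / (1 + R.G z)"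

lemma \<Omega>_of_real: "\<Omega> (of_real z) = of_real (\<omega> z)"
  by (simp add: \<Omega>_def \<omega>_def R.G_of_real)

lemma \<omega>_less: "z < r \<Longrightarrow> \<omega> z < z"
  using \<beta> R.stieltjes_pos[of z] by (simp add: \<omega>_def)

lemma \<omega>_strict_mono:
  assumes "x < y" "y < r"
  shows "\<omega> x < \<omega> y"
proof -
  have "0 < stieltjes R x" "stieltjes R x < stieltjes R y"
    using assms R.stieltjes_pos[of x] R.stieltjes_strict_mono[of x y] by auto
  then have "\<beta> / (1 + stieltjes R y) \<le> \<beta> / (1 + stieltjes R x)"
    using \<beta> by (intro divide_left_mono mult_pos_pos) auto
  then show ?thesis using assms by (simp add: \<omega>_def)
qed

lemma continuous_\<omega>: "z < r \<Longrightarrow> isCont \<omega> z"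
  using R.stieltjes_pos[of z] unfolding \<omega>_def
  by (intro continuous_intros R.continuous_stieltjes) auto

lemma one_plus_G_nonzero: "Re z < r \<Longrightarrow> 1 + R.G z \<noteq> 0"
  using R.Re_G_pos[of z] by (metis add_pos_pos less_irrefl one_complex.sel(1) plus_complex.sel(1) zero_complex.sel(1) zero_less_one)

lemma holomorphic_R_G: "R.G holomorphic_on {z. Re z < r}"
  by (rule holomorphic_on_subset[OF R.holomorphic_G]) auto

lemma holomorphic_\<Omega>: "\<Omega> holomorphic_on {z. Re z < r}"
  unfolding \<Omega>_def using one_plus_G_nonzero
  by (intro holomorphic_intros holomorphic_R_G) auto

text \<open>The imaginary part of - \<beta> / (1 + G) is \<beta> Im G / |1 + G|^2 and has the sign
  of Im z. So \<Omega> can meet the half-line from \<open>n\<close> on, outside the known domain of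
  \<open>N.G\<close>, only at real arguments.\<close>

lemma Im_\<Omega>:
  assumes "Re z < r" "Im z \<noteq> 0"
  shows "Im (\<Omega> z) \<noteq> 0"
proof -
  let ?g = "1 + R.G z"
  define D where "D = (Re ?g)\<^sup>2 + (Im ?g)\<^sup>2"
  have "Re ?g > 0" using R.Re_G_pos[OF assms(1)] by simp
  then have D: "D > 0" unfolding D_def by (simp add: add_pos_nonneg)
  have eq: "Im (\<Omega> z) = Im z + \<beta> * Im (R.G z) / D"
    by (simp add: \<Omega>_def Im_divide D_def)
  consider "Im z > 0" | "Im z < 0" using assms by linarith
  then show ?thesis
  proof cases
    case 1
    have "\<beta> * Im (R.G z) / D > 0"
      using R.Im_G(1)[OF assms(1) 1] \<beta> D by simp
    then show ?thesis using 1 eq by simp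
  next
    case 2
    have "\<beta> * Im (R.G z) / D < 0"
      using R.Im_G(2)[OF assms(1) 2] \<beta> D by (simp add: divide_neg_pos mult_pos_neg)
    then show ?thesis using 2 eq by simp
  qed
qed

text \<open>\<Omega> maps the half-plane left of \<open>z1\<close> into the domain of
  \<open>N.G\<close>, so the identity continues from a left half-line. \<open>z1\<close> is kept
  general for two uses: a hypothetical point where \<omega> reaches \<open>n\<close>, and
  \<open>r\<close> itself.\<close>

lemma subordinate_below:
  assumes z1: "z1 \<le> r" and below: "\<And>z. z < z1 \<Longrightarrow> \<omega> z < n" and z: "z < z1"
  shows "stieltjes N (\<omega> z) = stieltjes R z"
proof -
  let ?S = "{z. Re z < z1}"
  obtain z0 where z0: "\<And>z. z \<le> z0 \<Longrightarrow> stieltjes N (\<omega> z) = stieltjes R z"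
    using near_infinity unfolding eventually_at_bot_linorder \<omega>_def by blast
  \<comment> \<open>Subtracting 1 puts \<xi> strictly inside the half-plane and to the left of
    \<open>z0\<close>; it is a limit point of the half-line \<open>?U\<close>.\<close>
  define \<xi> where "\<xi> = min z0 z1 - 1"
  let ?U = "complex_of_real ` {..<\<xi>}"
  have "N.G (\<Omega> (of_real z)) - R.G (of_real z) = 0"
  proof (rule analytic_continuation[where f = "\<lambda>z. N.G (\<Omega> z) - R.G z" and w = "of_real z"])
    show "(\<lambda>z. N.G (\<Omega> z) - R.G z) holomorphic_on ?S"
    proof (rule holomorphic_on_diff)
      have \<Omega>: "\<Omega> holomorphic_on ?S"
        by (rule holomorphic_on_subset[OF holomorphic_\<Omega>]) (use z1 in auto)
      have "\<Omega> ` ?S \<subseteq> {z. Re z < n \<or> Im z \<noteq> 0}"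
      proof (rule image_subsetI)
        fix z assume z: "z \<in> ?S"
        have "Re (\<Omega> z) < n" if "Im (\<Omega> z) = 0"
        proof -
          have "Im z = 0" using Im_\<Omega>[of z] z z1 that by auto
          then have "z = of_real (Re z)" by (simp add: complex_eq_iff)
          then show ?thesis
            using below[of "Re z"] z by (metis \<Omega>_of_real Re_complex_of_real mem_Collect_eq)
        qed
        then show "\<Omega> z \<in> {z. Re z < n \<or> Im z \<noteq> 0}" by auto
      qed
      from holomorphic_on_compose_gen[OF \<Omega> N.holomorphic_G this]
      show "(\<lambda>z. N.G (\<Omega> z)) holomorphic_on ?S" by (simp add: o_def)
      show "R.G holomorphic_on ?S"
        by (rule holomorphic_on_subset[OF holomorphic_R_G]) (use z1 in auto)
    qed
    show "open ?S" by (rule open_halfspace_Re_lt)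
    show "connected ?S" by (intro convex_connected convex_halfspace_Re_lt)
    show "?U \<subseteq> ?S" by (auto simp: \<xi>_def)
    show "complex_of_real \<xi> \<in> ?S" "complex_of_real z \<in> ?S" using z by (auto simp: \<xi>_def)
    show "complex_of_real \<xi> islimpt ?U"
      unfolding islimpt_approachable
    proof (intro allI impI)
      fix e :: real assume "e > 0"
      then show "\<exists>x'\<in>?U. x' \<noteq> complex_of_real \<xi> \<and> dist x' (complex_of_real \<xi>) < e"
        by (intro bexI[of _ "of_real (\<xi> - e / 2)"]) (auto simp: dist_of_real dist_real_def simp del: of_real_diff)
    qed
    show "N.G (\<Omega> u) - R.G u = 0" if "u \<in> ?U" for u
      using that z0 by (auto simp: \<Omega>_of_real N.G_of_real R.G_of_real \<xi>_def)
  qed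
  then show ?thesis
    by (simp add: \<Omega>_of_real N.G_of_real R.G_of_real)
qed

text \<open>On the real axis the derivative is 1 + \<beta> G' / (1 + G)^2 with G' > 0; this gives
  \<Omega> a local inverse there.\<close>

lemma \<Omega>_deriv_nonzero:
  assumes "z < r"
  shows "deriv \<Omega> (of_real z) \<noteq> 0"
proof -
  let ?g = "stieltjes R z" and ?z = "complex_of_real z"
  obtain D where D: "D > 0" "(R.G has_field_derivative complex_of_real D) (at ?z)"
    using R.G_deriv_of_real[OF assms] by blast
  have g: "1 + R.G ?z = complex_of_real (1 + ?g)" "1 + ?g > 0"
    using R.stieltjes_pos[OF assms] by (simp_all add: R.G_of_real)
  have nz: "1 + R.G ?z \<noteq> 0"
    using one_plus_G_nonzero[of ?z] assms by simp
  have "(\<Omega> has_field_derivative 1 - (0 * (1 + R.G ?z) - of_real \<beta> * (0 + of_real D))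
      / ((1 + R.G ?z) * (1 + R.G ?z))) (at ?z)"
    unfolding \<Omega>_def by (intro derivative_intros D nz)
  also have "1 - (0 * (1 + R.G ?z) - of_real \<beta> * (0 + of_real D))
      / ((1 + R.G ?z) * (1 + R.G ?z)) = complex_of_real (1 + \<beta> * D / ((1 + ?g) * (1 + ?g)))"
    unfolding g by simp
  finally have "deriv \<Omega> ?z = complex_of_real (1 + \<beta> * D / ((1 + ?g) * (1 + ?g)))"
    by (rule DERIV_imp_deriv)
  moreover have "1 + \<beta> * D / ((1 + ?g) * (1 + ?g)) > 0"
    using R.stieltjes_pos[OF assms] D \<beta> by (intro add_pos_pos divide_pos_pos mult_pos_pos) auto
  ultimately show ?thesis
    by (metis less_irrefl of_real_eq_0_iff)
qed

lemma \<omega>_below: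
  assumes "z < r"
  shows "\<omega> z < n"
proof (rule ccontr)
  assume "\<not> \<omega> z < n"
  \<comment> \<open>Since \<omega> z0 < z0 < n, the intermediate value theorem yields a point where
    \<omega> equals \<open>n\<close>.\<close>
  define z0 where "z0 = min z n - 1"
  have "z0 < r" "z0 < n" using assms by (auto simp: z0_def)
  then have "\<omega> z0 \<le> n" using \<omega>_less[of z0] by simp
  moreover have "n \<le> \<omega> z" using \<open>\<not> \<omega> z < n\<close> by simp
  ultimately have "\<exists>x\<ge>z0. x \<le> z \<and> \<omega> x = n"
    using assms by (intro IVT) (auto simp: z0_def intro!: continuous_\<omega>)
  then obtain z1 where z1: "z1 < r" "\<omega> z1 = n"
    using assms by (auto intro: le_less_trans)
  have sub: "stieltjes N (\<omega> x) = stieltjes R x" if "x < z1" for x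
    by (rule subordinate_below[of z1]) (use z1 that \<omega>_strict_mono in auto)
  let ?S = "{z. Re z < r}"
  obtain d where d: "d > 0" "ball (complex_of_real z1) d \<subseteq> ?S" "open (\<Omega> ` ball (of_real z1) d)" "inj_on \<Omega> (ball (of_real z1) d)"
    by (rule has_complex_derivative_locally_invertible[OF holomorphic_\<Omega>, of "of_real z1"])
       (use z1 \<Omega>_deriv_nonzero in \<open>auto intro: open_halfspace_Re_lt\<close>)
  let ?B = "ball (complex_of_real z1) d"
  obtain g where g: "g holomorphic_on (\<Omega> ` ?B)" "\<And>z. z \<in> ?B \<Longrightarrow> g (\<Omega> z) = z"
    using holomorphic_has_inverse[OF holomorphic_on_subset[OF holomorphic_\<Omega> d(2)] open_ball d(4)] by metis
  have "complex_of_real n \<in> \<Omega> ` ?B"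
    using z1 d \<Omega>_of_real[of z1] by (metis centre_in_ball imageI)
  then obtain e where e: "e > 0" "ball (complex_of_real n) e \<subseteq> \<Omega> ` ?B"
    using d(3) open_contains_ball by blast
  \<comment> \<open>With \<open>e'\<close> chosen from \<open>y\<close>, every w in (n - e', n) is
    \<omega> x for an x between \<open>y\<close> and \<open>z1\<close>, inside the ball on which
    \<open>g\<close> inverts \<Omega>. There subordination to the left of \<open>z1\<close>
    identifies \<open>R.G \<circ> g\<close> with \<open>stieltjes N\<close>.\<close>
  define y where "y = z1 - d / 2"
  have y: "y < z1" "y < r" using d z1 by (auto simp: y_def)
  define e' where "e' = min e (n - \<omega> y)"
  have e': "e' > 0" "e' \<le> e" "e' \<le> n - \<omega> y"
    using e \<omega>_strict_mono[of y z1] y z1 by (auto simp: e'_def)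
  show False
  proof (rule N.no_holomorphic_extension[OF mass e'(1)])
    have "g ` ball (of_real n) e' \<subseteq> ?S"
    proof (rule image_subsetI)
      fix w assume "w \<in> ball (complex_of_real n) e'"
      then have "w \<in> ball (complex_of_real n) e" using e'(2) by simp
      then obtain x where "x \<in> ?B" "w = \<Omega> x" using e(2) by blast
      then show "g w \<in> ?S" using g(2) d(2) by auto
    qed
    moreover have "ball (complex_of_real n) e' \<subseteq> \<Omega> ` ?B"
      using e(2) e'(2) subset_ball[of e' e] by blast
    then have "g holomorphic_on ball (of_real n) e'"
      by (rule holomorphic_on_subset[OF g(1)])
    ultimately show "R.G \<circ> g holomorphic_on ball (of_real n) e'"
      using holomorphic_on_compose_gen[OF _ holomorphic_R_G] by blast
    show "(R.G \<circ> g) (of_real w) = of_real (stieltjes N w)" if "n - e' < w" "w < n" for w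
    proof -
      have "\<exists>x\<ge>y. x \<le> z1 \<and> \<omega> x = w"
        using that e' y z1 by (intro IVT) (auto intro!: continuous_\<omega>)
      then obtain x where x: "y \<le> x" "x \<le> z1" "\<omega> x = w" by blast
      have "x \<noteq> z1" using x z1 that by auto
      then have "x < z1" using x by simp
      have "complex_of_real x \<in> ?B"
        using x \<open>d > 0\<close> by (auto simp: y_def dist_of_real dist_real_def)
      then have "g (of_real w) = of_real x"
        using g(2)[of "of_real x"] x by (simp add: \<Omega>_of_real)
      then show ?thesis
        using sub[OF \<open>x < z1\<close>] x by (simp add: R.G_of_real)
    qed
  qed
qed

theorem subordinate:
  assumes "z < r"
  shows "stieltjes N (\<omega> z) = stieltjes R z"
  by (rule subordinate_below[of r]) (use assms \<omega>_below in auto)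

end

text \<open>Convergence of the formal \<open>Y\<close> comes from solving its linear equation: it is
  rational in the moment series of \<rho>, hence the expansion of an actual function
  \<open>h\<close>. The formal identity then holds for functions near 0 and is read at t =
  1/z.\<close>

lemma free_poisson_near_infinity:
  assumes \<beta>: "\<beta> > 0" and conv: "is_free_convolution (marchenko_pastur \<beta>) \<nu> \<rho>"
    and "bounded_law \<nu> n B" "bounded_law \<rho> r A"
  shows "\<forall>\<^sub>F z in at_bot. stieltjes \<nu> (z - \<beta> / (1 + stieltjes \<rho> z)) = stieltjes \<rho> z"
proof -
  interpret N: bounded_law \<nu> n B by fact
  interpret R: bounded_law \<rho> r A by fact
  interpret P: bounded_law "marchenko_pastur \<beta>" 0 "mp_plus \<beta>"
    by (rule marchenko_pastur_bounded_law[OF \<beta>])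
  obtain \<phi> where \<phi>: "joint_distribution \<phi>" "free_pair \<phi>" "has_law \<phi> (nc_var False) (marchenko_pastur \<beta>)"
      "has_law \<phi> (nc_var True) \<nu>" "has_law \<phi> (nc_var False + nc_var True) \<rho>"
    using conv by (auto simp: is_free_convolution_def)
  obtain Y where Y: "Y $ 0 = 0" "N.moment_fps oo Y = R.moment_fps"
      "(1 - R.moment_fps) * Y = (1 - R.moment_fps) * fps_X + fps_const (of_real \<beta>) * Y * fps_X"
    unfolding N.moment_fps_def R.moment_fps_def
    by (rule formal_subordination[OF \<phi>(1,2) \<phi>(3-5)[unfolded has_law_def, rule_format]
          marchenko_pastur_moment_fps[OF \<beta>, unfolded P.moment_fps_def]])
  define h where "h = (\<lambda>t. (1 - R.moment_fun t) * t * inverse (1 - R.moment_fun t - of_real \<beta> * t))"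
  have R0: "R.moment_fps $ 0 = 0" by (simp add: R.moment_fps_def)
  have Y_eq: "Y = (1 - R.moment_fps) * fps_X * inverse (1 - R.moment_fps - fps_const (of_real \<beta>) * fps_X)"
  proof -
    let ?D = "1 - R.moment_fps - fps_const (of_real \<beta>) * fps_X"
    have YD: "Y * ?D = (1 - R.moment_fps) * fps_X"
      using Y(3) by (simp add: algebra_simps)
    have "?D * inverse ?D = 1"
      by (rule inverse_mult_eq_1') (simp add: R0)
    then have "Y = Y * ?D * inverse ?D"
      by (simp only: mult.assoc mult_1_right)
    then show ?thesis
      by (simp only: YD)
  qed
  have "h has_fps_expansion Y"
    unfolding h_def Y_eq
    by (intro fps_expansion_intros R.moment_fun_has_fps_expansion) (simp add: R0)
  then have "(N.moment_fun \<circ> h) has_fps_expansion (N.moment_fps oo Y)"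
    by (rule has_fps_expansion_compose[OF N.moment_fun_has_fps_expansion]) (rule Y(1))
  then have "\<forall>\<^sub>F t in nhds 0. (N.moment_fun \<circ> h) t = R.moment_fun t"
    using R.moment_fun_has_fps_expansion unfolding Y(2) has_fps_expansion_def
    by (auto elim: eventually_elim2)
  moreover have "filterlim (\<lambda>z. complex_of_real (1 / z)) (nhds 0) at_bot"
  proof -
    have "((\<lambda>z::real. 1 / z) \<longlongrightarrow> 0) at_bot" by real_asymp
    then have "((\<lambda>z. complex_of_real (1 / z)) \<longlongrightarrow> of_real 0) at_bot" by (rule tendsto_of_real)
    then show ?thesis by simp
  qed
  ultimately have "\<forall>\<^sub>F z in at_bot. (N.moment_fun \<circ> h) (complex_of_real (1 / z)) = R.moment_fun (complex_of_real (1 / z))"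
    by (rule eventually_compose_filterlim)
  then show ?thesis
    using eventually_gt_at_bot[of r] eventually_gt_at_bot[of n] eventually_gt_at_bot[of 0]
  proof eventually_elim
    case (elim z)
    let ?g = "stieltjes \<rho> z"
    define w where "w = z - \<beta> / (1 + ?g)"
    have g: "?g > 0" using R.stieltjes_pos elim by simp
    have w: "w < z" using g \<beta> by (simp add: w_def)
    have Rz: "R.moment_fun (complex_of_real (1 / z)) = - of_real ?g"
      using elim by (intro R.moment_fun_real) auto
    have real: "(1 + ?g) * (1 / z) * inverse (1 + ?g - \<beta> * (1 / z)) = 1 / w"
    proof -
      have "w * z \<noteq> 0" using w elim by simp
      moreover have "1 + ?g - \<beta> * (1 / z) = (1 + ?g) * (w / z)"
      proof -
        have "(1 + ?g) * (\<beta> / (1 + ?g)) = \<beta>" using g by simp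
        then have "(1 + ?g) * w = (1 + ?g) * z - \<beta>" by (simp add: w_def right_diff_distrib)
        then show ?thesis using elim by (simp add: diff_divide_distrib)
      qed
      ultimately show ?thesis using g by simp
    qed
    have "h (of_real (1 / z)) = of_real ((1 + ?g) * (1 / z) * inverse (1 + ?g - \<beta> * (1 / z)))"
      unfolding h_def Rz by simp
    then have "h (of_real (1 / z)) = of_real (1 / w)"
      by (simp only: real)
    then have "N.moment_fun (of_real (1 / w)) = - of_real ?g"
      using elim Rz by simp
    moreover have "N.moment_fun (of_real (1 / w)) = - of_real (stieltjes \<nu> w)"
      using elim w by (intro N.moment_fun_real) auto
    ultimately show ?case
      by (simp add: w_def)
  qed
qed

section \<open>The variational formula\<close>

text \<open>The transform increases, so its left limit is a supremum; a bound g <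
  \<open>g_star M\<close> thereby yields a point below \<open>s\<close> whose transform exceeds
  g.\<close>

lemma (in bounded_law) g_star_eq_SUP:
  assumes "supp_minus M = s"
  shows "g_star M = (SUP z\<in>{..<s}. ereal (stieltjes M z))"
proof -
  let ?l = "SUP z\<in>{..<s}. ereal (stieltjes M z)"
  have "((\<lambda>z. ereal (stieltjes M z)) \<longlongrightarrow> ?l) (at_left s)"
  proof (rule increasing_tendsto)
    show "\<forall>\<^sub>F z in at_left s. ereal (stieltjes M z) \<le> ?l"
    proof -
      have "\<forall>\<^sub>F z in at_left s. z < s" by (simp add: eventually_at_filter)
      then show ?thesis by eventually_elim (auto intro: SUP_upper)
    qed
    fix x assume "x < ?l"
    then obtain z where z: "z < s" "x < ereal (stieltjes M z)"
      by (auto simp: less_SUP_iff)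
    have "\<forall>\<^sub>F y in at_left s. y \<in> {z<..<s}"
      by (rule eventually_at_leftI[of z]) (use z in auto)
    then show "\<forall>\<^sub>F y in at_left s. x < ereal (stieltjes M y)"
      by eventually_elim (use z stieltjes_strict_mono in \<open>force intro: less_trans\<close>)
  qed
  then show ?thesis
    unfolding g_star_def assms by (intro tendsto_Lim) auto
qed

section \<open>The objective, its minimum and the value there\<close>

context subordination
begin

definition objective :: "real \<Rightarrow> real \<Rightarrow> real" where
  "objective z g = \<beta> * ln (1 + g) - \<beta> * g / (1 + g) + (\<integral>x. ln (x - (z - \<beta> / (1 + g))) \<partial>N)"

lemma shift_mono: "0 \<le> x \<Longrightarrow> x \<le> y \<Longrightarrow> z - \<beta> / (1 + x) \<le> z - \<beta> / (1 + y)"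
  using \<beta> by (intro diff_left_mono divide_left_mono) auto

lemma objective_deriv:
  assumes "g > 0" "z - \<beta> / (1 + g) < n"
  shows "(objective z has_real_derivative \<beta> / (1 + g)\<^sup>2 * (g - stieltjes N (z - \<beta> / (1 + g)))) (at g)"
proof -
  let ?w = "\<lambda>g. z - \<beta> / (1 + g)"
  have w: "(?w has_real_derivative \<beta> / (1 + g)\<^sup>2) (at g)"
    using assms by (auto intro!: derivative_eq_intros simp: power2_eq_square)
  have ln: "((\<lambda>g. \<integral>x. ln (x - ?w g) \<partial>N) has_real_derivative - stieltjes N (?w g) * (\<beta> / (1 + g)\<^sup>2)) (at g)"
    by (rule DERIV_chain2[OF N.ln_integral_deriv[OF assms(2)] w])
  have "((\<lambda>g. \<beta> * ln (1 + g) - \<beta> * g / (1 + g)) has_real_derivative \<beta> / (1 + g) - \<beta> / (1 + g)\<^sup>2) (at g)"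
    using assms by (auto intro!: derivative_eq_intros simp: power2_eq_square) (simp add: field_simps)
  from DERIV_add[OF this ln]
  have "(objective z has_real_derivative \<beta> / (1 + g) - \<beta> / (1 + g)\<^sup>2 + - stieltjes N (?w g) * (\<beta> / (1 + g)\<^sup>2)) (at g)"
    unfolding objective_def .
  moreover have "\<beta> / (1 + g) - \<beta> / (1 + g)\<^sup>2 + - y * (\<beta> / (1 + g)\<^sup>2) = \<beta> / (1 + g)\<^sup>2 * (g - y)" for y
  proof -
    define k where "k = \<beta> / (1 + g)\<^sup>2"
    have "\<beta> / (1 + g) = k * (1 + g)"
      using assms by (simp add: k_def power2_eq_square)
    then show ?thesis
      unfolding k_def[symmetric] by (simp only:) (simp add: algebra_simps)
  qed
  ultimately show ?thesis by simp
qed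

text \<open>Such a \<open>g\<close> is \<open>stieltjes R x\<close> for some x \<le> z.
  Subordination at x gives g = \<open>stieltjes N (x - \<beta> / (1 + g))\<close>, and moving x up
  to z with \<open>g\<close> held fixed can only increase the right-hand side.\<close>

lemma stieltjes_N_ge:
  assumes z: "z < r" and g: "0 < g" "g \<le> stieltjes R z"
  shows "g \<le> stieltjes N (z - \<beta> / (1 + g))"
proof -
  have "\<forall>\<^sub>F y in at_bot. stieltjes R y < g"
    using R.stieltjes_tendsto_0 g by (intro order_tendstoD) auto
  then have "\<forall>\<^sub>F y in at_bot. stieltjes R y < g \<and> y < z"
    using eventually_gt_at_bot[of z] by eventually_elim auto
  then obtain y where y: "stieltjes R y < g" "y < z"
    using eventually_happens trivial_limit_at_bot_linorder by blast
  have "\<exists>x\<ge>y. x \<le> z \<and> stieltjes R x = g"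
    using y g z by (intro IVT) (auto intro: R.continuous_stieltjes)
  then obtain x where x: "x \<le> z" "stieltjes R x = g" by blast
  have "g = stieltjes N (x - \<beta> / (1 + g))"
    using subordinate[of x] x z by (simp add: \<omega>_def)
  also have "\<dots> \<le> stieltjes N (z - \<beta> / (1 + g))"
  proof (cases "x = z")
    case False
    have "z - \<beta> / (1 + g) \<le> \<omega> z"
      unfolding \<omega>_def using g by (intro shift_mono) auto
    also have "\<dots> < n" by (rule \<omega>_below[OF z])
    finally show ?thesis
      using False x by (intro less_imp_le N.stieltjes_strict_mono) auto
  qed simp
  finally show ?thesis .
qed

text \<open>The mirror argument with x \<ge> z; \<open>y\<close> shows that the transform attains
  \<open>g\<close>, and keeps x below \<open>r\<close>.\<close>

lemma stieltjes_N_le: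
  assumes z: "z < r" and g: "stieltjes R z \<le> g" and y: "y < r" "g \<le> stieltjes R y"
  shows "stieltjes N (z - \<beta> / (1 + g)) \<le> g"
proof -
  have "z \<le> y"
    using R.stieltjes_mono_iff[of y z] g y z by linarith
  then have "\<exists>x\<ge>z. x \<le> y \<and> stieltjes R x = g"
    using g y z by (intro IVT) (auto intro: R.continuous_stieltjes)
  then obtain x where x: "z \<le> x" "x < r" "stieltjes R x = g"
    using y by (auto intro: le_less_trans)
  have "x - \<beta> / (1 + g) < n"
    using \<omega>_below[of x] x by (simp add: \<omega>_def)
  then have "stieltjes N (z - \<beta> / (1 + g)) \<le> stieltjes N (x - \<beta> / (1 + g))"
    using x by (cases "x = z") (auto intro!: less_imp_le N.stieltjes_strict_mono)
  also have "\<dots> = g"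
    using subordinate[of x] x by (simp add: \<omega>_def)
  finally show ?thesis .
qed

text \<open>The derivative has the right sign all along the segment between \<open>g\<close> and
  \<open>stieltjes R z\<close>. The shifted argument increases in the variable, so it stays below
  \<open>n\<close> on the segment once it does at the larger end.\<close>

lemma objective_minimal:
  assumes z: "z < r" and g: "0 < g" "z - \<beta> / (1 + g) < n" and y: "y < r" "g \<le> stieltjes R y"
  shows "objective z (stieltjes R z) \<le> objective z g"
proof (cases "g \<le> stieltjes R z")
  case True
  show ?thesis
  proof (rule DERIV_nonpos_imp_nonincreasing[OF True])
    fix x assume x: "g \<le> x" "x \<le> stieltjes R z"
    have "z - \<beta> / (1 + x) \<le> \<omega> z"
      unfolding \<omega>_def using x g by (intro shift_mono) auto
    also have "\<dots> < n" by (rule \<omega>_below[OF z])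
    finally have d: "(objective z has_real_derivative \<beta> / (1 + x)\<^sup>2 * (x - stieltjes N (z - \<beta> / (1 + x)))) (at x)"
      using x g by (intro objective_deriv) auto
    have "x \<le> stieltjes N (z - \<beta> / (1 + x))"
      using x g by (intro stieltjes_N_ge[OF z]) auto
    then have "\<beta> / (1 + x)\<^sup>2 * (x - stieltjes N (z - \<beta> / (1 + x))) \<le> 0"
      using \<beta> by (intro mult_nonneg_nonpos) auto
    with d show "\<exists>D. (objective z has_real_derivative D) (at x) \<and> D \<le> 0" by blast
  qed
next
  case False
  then have le: "stieltjes R z \<le> g" by simp
  show ?thesis
  proof (rule DERIV_nonneg_imp_nondecreasing[OF le])
    fix x assume x: "stieltjes R z \<le> x" "x \<le> g"
    have x0: "x > 0" using R.stieltjes_pos[OF z] x by linarith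
    then have "z - \<beta> / (1 + x) \<le> z - \<beta> / (1 + g)"
      using x by (intro shift_mono) auto
    also have "\<dots> < n" by (rule g(2))
    finally have d: "(objective z has_real_derivative \<beta> / (1 + x)\<^sup>2 * (x - stieltjes N (z - \<beta> / (1 + x)))) (at x)"
      using x0 by (intro objective_deriv) auto
    have "stieltjes N (z - \<beta> / (1 + x)) \<le> x"
      using x y by (intro stieltjes_N_le[OF z _ y(1)]) auto
    then have "\<beta> / (1 + x)\<^sup>2 * (x - stieltjes N (z - \<beta> / (1 + x))) \<ge> 0"
      using \<beta> by (intro mult_nonneg_nonneg) auto
    with d show "\<exists>D. (objective z has_real_derivative D) (at x) \<and> D \<ge> 0" by blast
  qed
qed

lemma filterlim_\<omega>: "filterlim \<omega> at_bot at_bot"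
  unfolding filterlim_at_bot
proof
  fix Z
  show "\<forall>\<^sub>F z in at_bot. \<omega> z \<le> Z"
    using eventually_gt_at_bot[of r] eventually_gt_at_bot[of Z]
    by eventually_elim (use \<omega>_less in force)
qed

text \<open>Criticality in \<open>g\<close> makes the derivative of the right-hand side equal to the partial
  derivative in \<open>z\<close>, that is, to \<open>- G\<^sub>\<nu>(\<omega> z) = - G\<^sub>\<rho>(z)\<close>.\<close>

lemma log_potential_eq_objective:
  assumes "z < r"
  shows "log_potential R z = objective z (stieltjes R z)"
proof -
  let ?s = "stieltjes R"
  let ?LR = "\<lambda>z. \<integral>x. ln (x - z) \<partial>R" and ?LN = "\<lambda>w. \<integral>x. ln (x - w) \<partial>N"
  define D where "D = (\<lambda>z. ?LR z - objective z (?s z))"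
  have obj: "objective z (?s z) = \<beta> * ln (1 + ?s z) - \<beta> * ?s z / (1 + ?s z) + ?LN (\<omega> z)" for z
    by (simp add: objective_def \<omega>_def)
  have deriv: "(D has_real_derivative 0) (at z)" if z: "z < r" for z
  proof -
    obtain s' where s': "(?s has_real_derivative s') (at z)"
      using R.stieltjes_deriv[OF z] by blast
    have s: "1 + ?s z > 0" using R.stieltjes_pos[OF z] by simp
    \<comment> \<open>\<open>k\<close> is the derivative of \<omega> minus 1; all terms caused by
      the variation of \<open>?s z\<close> are multiples of it and cancel by subordination.\<close>
    define k where "k = \<beta> * s' / (1 + ?s z)\<^sup>2"
    have k: "\<beta> * s' / (1 + ?s z) = k * (1 + ?s z)"
      using s by (simp add: k_def power2_eq_square)
    have \<omega>: "(\<omega> has_real_derivative 1 + k) (at z)"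
      unfolding \<omega>_def using s
      by (auto intro!: derivative_eq_intros s' simp: k_def power2_eq_square)
    have "((\<lambda>z. ?LN (\<omega> z)) has_real_derivative - stieltjes N (\<omega> z) * (1 + k)) (at z)"
      by (rule DERIV_chain2[OF N.ln_integral_deriv[OF \<omega>_below[OF z]] \<omega>])
    moreover have "((\<lambda>z. \<beta> * ln (1 + ?s z)) has_real_derivative k * (1 + ?s z)) (at z)"
      unfolding k[symmetric] using s
      by (auto intro!: derivative_eq_intros s')
    moreover have "((\<lambda>z. \<beta> * ?s z / (1 + ?s z)) has_real_derivative k) (at z)"
      using s by (auto intro!: derivative_eq_intros s' simp: k_def power2_eq_square) (simp add: algebra_simps)
    ultimately have "((\<lambda>z. objective z (?s z)) has_real_derivative
        k * (1 + ?s z) - k + - stieltjes N (\<omega> z) * (1 + k)) (at z)"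
      unfolding obj by (intro derivative_intros)
    then have "((\<lambda>z. objective z (?s z)) has_real_derivative - ?s z) (at z)"
      by (simp add: subordinate[OF z] algebra_simps)
    from DERIV_diff[OF R.ln_integral_deriv[OF z] this]
    show ?thesis by (simp add: D_def)
  qed
  have "\<exists>c. \<forall>z\<in>{..<r}. D z = c"
    by (rule has_field_derivative_zero_constant) (auto intro: has_field_derivative_at_within deriv)
  then obtain c where c: "\<And>z. z < r \<Longrightarrow> D z = c" by auto
  have "(D \<longlongrightarrow> 0) at_bot"
  proof -
    \<comment> \<open>The two asymptotics are normalized by ln (- z) and ln (- \<omega> z);
      \<open>?q\<close> is the logarithm of \<omega>(z) / z, which tends to 0 and reconciles
      them.\<close>
    let ?q = "\<lambda>z. ln (1 - \<beta> / (1 + ?s z) * (1 / z))"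
    have s0: "(?s \<longlongrightarrow> 0) at_bot" by (rule R.stieltjes_tendsto_0)
    have "((\<lambda>z::real. 1 / z) \<longlongrightarrow> 0) at_bot" by real_asymp
    then have q: "(?q \<longlongrightarrow> ln (1 - \<beta> / (1 + 0) * 0)) at_bot"
      by (intro tendsto_intros s0) auto
    have mid: "((\<lambda>z. \<beta> * ln (1 + ?s z) - \<beta> * ?s z / (1 + ?s z)) \<longlongrightarrow> \<beta> * ln (1 + 0) - \<beta> * 0 / (1 + 0)) at_bot"
      by (intro tendsto_intros s0) auto
    have LN: "((\<lambda>z. ?LN (\<omega> z) - ln (- \<omega> z)) \<longlongrightarrow> 0) at_bot"
      by (rule filterlim_compose[OF N.ln_integral_asymp filterlim_\<omega>])
    from tendsto_diff[OF tendsto_diff[OF tendsto_diff[OF R.ln_integral_asymp mid] LN] q]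
    have "((\<lambda>z. (?LR z - ln (- z)) - (\<beta> * ln (1 + ?s z) - \<beta> * ?s z / (1 + ?s z))
        - (?LN (\<omega> z) - ln (- \<omega> z)) - ?q z) \<longlongrightarrow> 0) at_bot"
      by simp
    moreover have "\<forall>\<^sub>F z in at_bot. (?LR z - ln (- z)) - (\<beta> * ln (1 + ?s z) - \<beta> * ?s z / (1 + ?s z))
        - (?LN (\<omega> z) - ln (- \<omega> z)) - ?q z = D z"
      using eventually_gt_at_bot[of r] eventually_gt_at_bot[of 0]
    proof eventually_elim
      case (elim z)
      have w: "\<omega> z < 0" using \<omega>_less[of z] elim by simp
      have eq: "1 - \<beta> / (1 + ?s z) * (1 / z) = (- \<omega> z) / (- z)"
        using elim by (simp add: \<omega>_def diff_divide_distrib)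
      have "?q z = ln (- \<omega> z) - ln (- z)"
        unfolding eq using w elim by (intro ln_divide_pos) auto
      then show ?case by (simp add: D_def obj)
    qed
    ultimately show ?thesis by (rule Lim_transform_eventually)
  qed
  moreover have "(D \<longlongrightarrow> c) at_bot"
  proof (rule tendsto_eventually)
    show "\<forall>\<^sub>F z in at_bot. D z = c"
      using eventually_gt_at_bot[of r] by eventually_elim (rule c)
  qed
  ultimately have "c = 0"
    using tendsto_unique trivial_limit_at_bot_linorder by blast
  then show ?thesis
    using c[OF assms] by (simp add: D_def R.log_potential_below[OF assms])
qed

end

theorem mainTheorem3:
  fixes \<beta> :: real and \<mu> \<nu> \<rho> :: "real measure"
  assumes "\<beta> > 0"
    and "\<mu> = marchenko_pastur \<beta>"
    and "cs_prob \<nu>"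
    and "is_free_convolution \<mu> \<nu> \<rho>"
  shows "\<forall>z<supp_minus \<rho>.
    ereal (log_potential \<rho> z) =
      (INF g \<in> {g :: real. 0 < g \<and> ereal g < g_star \<rho> \<and> z - supp_minus \<nu> < \<beta> / (1 + g)}.
        ereal (\<beta> * ln (1 + g) - \<beta> * g / (1 + g) + (\<integral>x. ln (x - z + \<beta> / (1 + g)) \<partial>\<nu>)))"
proof (intro allI impI)
  fix z assume z: "z < supp_minus \<rho>"
  have conv: "is_free_convolution (marchenko_pastur \<beta>) \<nu> \<rho>"
    using assms by simp
  then have "cs_prob \<rho>" by (simp add: is_free_convolution_def)
  then obtain A where R: "bounded_law \<rho> (supp_minus \<rho>) A"
    by (rule cs_prob_bounded_law)
  obtain B where N: "bounded_law \<nu> (supp_minus \<nu>) B"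
      and mass: "\<And>\<epsilon>. \<epsilon> > 0 \<Longrightarrow> emeasure \<nu> {..<supp_minus \<nu> + \<epsilon>} > 0"
    using cs_prob_bounded_law[OF assms(3)] by metis
  interpret subordination \<rho> \<nu> "supp_minus \<rho>" A "supp_minus \<nu>" B \<beta>
    by (intro subordination.intro subordination_axioms.intro R N assms(1) mass
        free_poisson_near_infinity[OF assms(1) conv N R])
  let ?I = "{g :: real. 0 < g \<and> ereal g < g_star \<rho> \<and> z - supp_minus \<nu> < \<beta> / (1 + g)}"
  have obj: "\<beta> * ln (1 + g) - \<beta> * g / (1 + g) + (\<integral>x. ln (x - z + \<beta> / (1 + g)) \<partial>\<nu>) = objective z g" for g
    by (simp add: objective_def diff_diff_eq2 diff_add_eq)
  have g_star: "g_star \<rho> = (SUP z\<in>{..<supp_minus \<rho>}. ereal (stieltjes \<rho> z))"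
    by (rule R.g_star_eq_SUP) simp
  have "ereal (objective z (stieltjes \<rho> z)) = (INF g\<in>?I. ereal (objective z g))"
  proof (rule antisym)
    show "ereal (objective z (stieltjes \<rho> z)) \<le> (INF g\<in>?I. ereal (objective z g))"
    proof (rule INF_greatest)
      fix g assume g: "g \<in> ?I"
      then obtain y where "y < supp_minus \<rho>" "g < stieltjes \<rho> y"
        by (auto simp: g_star less_SUP_iff)
      then show "ereal (objective z (stieltjes \<rho> z)) \<le> ereal (objective z g)"
        using g by (auto intro!: objective_minimal[OF z, of g y])
    qed
    show "(INF g\<in>?I. ereal (objective z g)) \<le> ereal (objective z (stieltjes \<rho> z))"
    proof (rule INF_lower)
      \<comment> \<open>The infimum is attained at \<open>stieltjes \<rho> z\<close>; a point
        strictly between z and the end of the support gives the strict bound by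
        \<open>g_star \<rho>\<close>.\<close>
      obtain y where y: "z < y" "y < supp_minus \<rho>"
        using dense[OF z] by blast
      have "ereal (stieltjes \<rho> z) < ereal (stieltjes \<rho> y)"
        using R.stieltjes_strict_mono[OF y] by simp
      also have "\<dots> \<le> g_star \<rho>"
        unfolding g_star using y by (intro SUP_upper) auto
      finally show "stieltjes \<rho> z \<in> ?I"
        using \<omega>_below[OF z] R.stieltjes_pos[OF z] by (simp add: \<omega>_def)
    qed
  qed
  then show "ereal (log_potential \<rho> z) = (INF g\<in>?I.
      ereal (\<beta> * ln (1 + g) - \<beta> * g / (1 + g) + (\<integral>x. ln (x - z + \<beta> / (1 + g)) \<partial>\<nu>)))"
    unfolding obj log_potential_eq_objective[OF z] .
qed

end
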